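(* Assume the eigenvalues $\lambda_1,\dots,\lambda_N$ of $R_r$ are pairwise distinct and the eigenvalues $\sigma_1,\dots,\sigma_N$ of $R_t$ are pairwise distinct, and let all parameters except $\rho$ be fixed. Define $$A(\rho)=\sum_{i=1}^N\sum_{m=1}^N\frac{\lambda_i^{-1}}{\prod_{j\ne i}(\lambda_i-\lambda_j)}\,\frac{\sigma_m^{-1}}{\prod_{n\ne m}(\sigma_m-\sigma_n)}\,\frac{1}{N!}\left[\frac{1}{(N-1)!}\Big(\frac{d_2^\tau}{\eta\theta}\Big)^N\Big(\sum_{l=1}^{N-1}\frac1l-C+\ln\frac{(1-\theta)\rho\lambda_i}{\gamma_{th}d_1^\tau}\Big)-\Big(\frac{-\sigma_m}{1-\theta}\Big)^N\right]\Big(\frac{\gamma_{th}d_1^\tau}{\rho}\Big)^N,$$ where $C$ is the Euler–Mascheroni constant. Then the outage probability $P_I(\rho)=P\{\gamma_I<\gamma_{th}\}$ satisfies $\lim_{\rho\to\infty}P_I(\rho)/A(\rho)=1$. In particular $P_I(\rho)$ decays like $\rho^{-N}\ln\rho$ (diversity order $N$).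
   Context: Fix an integer $N\ge 1$ and constants $\eta\in(0,1]$, $\theta\in(0,1)$, $d_1,d_2>0$, $\tau>0$, $\gamma_{th}>0$; $\rho>0$ is the variable. Let $R_r,R_t$ be $N\times N$ Hermitian positive definite matrices with eigenvalues $\lambda_1,\dots,\lambda_N>0$ and $\sigma_1,\dots,\sigma_N>0$ respectively. Let $h_{w1}\in\mathbb C^{N\times1}$, $h_{w2}\in\mathbb C^{1\times N}$ be independent with i.i.d. zero-mean circularly symmetric complex Gaussian entries of unit variance, $h_1=R_r^{1/2}h_{w1}$, $h_2=h_{w2}R_t^{1/2}$, and $$\gamma_I=\frac{\frac{\eta\theta(1-\theta)\rho^2}{d_1^{2\tau}d_2^\tau}\|h_2\|^2\|h_1\|^4}{\frac{\eta\theta\rho}{d_1^\tau d_2^\tau}\|h_2\|^2\|h_1\|^2+\frac{(1-\theta)\rho}{d_1^\tau}\|h_1\|^2+1}.$$ Empty products and empty sums equal $1$ and $0$ respectively. *)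

theory Defs
  imports "HOL-Probability.Probability"
begin

definition adjoint_mat :: "complex^'n^'n \<Rightarrow> complex^'n^'n" where
  "adjoint_mat A = (\<chi> i j. cnj (A $ j $ i))"

definition hermitian :: "complex^'n^'n \<Rightarrow> bool" where
  "hermitian A \<longleftrightarrow> adjoint_mat A = A"

definition herm_form :: "complex^'n^'n \<Rightarrow> complex^'n \<Rightarrow> complex" where
  "herm_form A x = (\<Sum>i\<in>UNIV. cnj (x $ i) * (A *v x) $ i)"

definition pos_def :: "complex^'n^'n \<Rightarrow> bool" where
  "pos_def A \<longleftrightarrow> hermitian A \<and> (\<forall>x. x \<noteq> 0 \<longrightarrow> Re (herm_form A x) > 0)"

definition pos_semidef :: "complex^'n^'n \<Rightarrow> bool" where
  "pos_semidef A \<longleftrightarrow> hermitian A \<and> (\<forall>x. Re (herm_form A x) \<ge> 0)"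

definition msqrt :: "complex^'n^'n \<Rightarrow> complex^'n^'n" where
  "msqrt R = (THE S. pos_semidef S \<and> S ** S = R)"

definition is_eigenvalue :: "complex^'n^'n \<Rightarrow> complex \<Rightarrow> bool" where
  "is_eigenvalue A c \<longleftrightarrow> (\<exists>v. v \<noteq> 0 \<and> A *v v = c *s v)"

text \<open>Density (w.r.t. Lebesgue measure on the complex plane) of a zero-mean circularly
  symmetric complex Gaussian with unit variance, CN(0,1).\<close>
definition cn_density :: "complex \<Rightarrow> ennreal" where
  "cn_density z = ennreal (exp (- (cmod z)\<^sup>2) / pi)"

text \<open>Instantaneous SNR gamma_I as a function of rho, and of h1 (column) and h2 (row).\<close>
definition gammaI ::
  "real \<Rightarrow> real \<Rightarrow> real \<Rightarrow> real \<Rightarrow> real \<Rightarrow> real \<Rightarrow> complex^'n \<Rightarrow> complex^'n \<Rightarrow> real" where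
  "gammaI \<eta> \<theta> d1 d2 \<tau> \<rho> h1 h2 =
     (\<eta> * \<theta> * (1 - \<theta>) * \<rho>\<^sup>2 / (d1 powr (2 * \<tau>) * d2 powr \<tau>) * (norm h2)\<^sup>2 * (norm h1)^4) /
     (\<eta> * \<theta> * \<rho> / (d1 powr \<tau> * d2 powr \<tau>) * (norm h2)\<^sup>2 * (norm h1)\<^sup>2
      + (1 - \<theta>) * \<rho> / d1 powr \<tau> * (norm h1)\<^sup>2 + 1)"

definition A_asym ::
  "('n::finite \<Rightarrow> real) \<Rightarrow> ('n \<Rightarrow> real) \<Rightarrow> real \<Rightarrow> real \<Rightarrow> real \<Rightarrow> real \<Rightarrow> real \<Rightarrow> real \<Rightarrow> real \<Rightarrow> real" where
  "A_asym lam sig \<eta> \<theta> d1 d2 \<tau> \<gamma>th \<rho> =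
    (let N = CARD('n) in
     (\<Sum>i\<in>UNIV. \<Sum>m\<in>UNIV.
        (inverse (lam i) / (\<Prod>j\<in>UNIV - {i}. (lam i - lam j))) *
        (inverse (sig m) / (\<Prod>n\<in>UNIV - {m}. (sig m - sig n))) *
        (1 / fact N) *
        (1 / fact (N - 1) * (d2 powr \<tau> / (\<eta> * \<theta>)) ^ N *
           ((\<Sum>l=1..N-1. 1 / real l) - euler_mascheroni
              + ln ((1 - \<theta>) * \<rho> * lam i / (\<gamma>th * d1 powr \<tau>)))
         - (- sig m / (1 - \<theta>)) ^ N) *
        (\<gamma>th * d1 powr \<tau> / \<rho>) ^ N))"

end

theory Submission
  imports Defs "HOL-Real_Asymp.Real_Asymp"
begin

text \<open>
  Write \<open>X = \<parallel>h\<^sub>1\<parallel>\<^sup>2\<close> and \<open>Y = \<parallel>h\<^sub>2\<parallel>\<^sup>2\<close>. The bracket in \<open>A\<close> is dominated by its \<open>ln \<rho>\<close> term, so only the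
  leading order of the outage probability matters; the sums over \<open>i\<close> and \<open>m\<close> of the coefficients of
  \<open>ln \<rho>\<close> are Lagrange interpolation sums and equal \<open>(-1)\<^sup>N\<^sup>-\<^sup>1 / \<Prod>\<lambda>\<close> and \<open>(-1)\<^sup>N\<^sup>-\<^sup>1 / \<Prod>\<sigma>\<close>.

  After a unitary change of variables \<open>{X \<le> x}\<close> is an ellipsoid of volume \<open>\<pi>\<^sup>N x\<^sup>N / (N! \<Prod>\<lambda>)\<close>, and the
  Gaussian density is close to \<open>\<pi>\<^sup>-\<^sup>N\<close> on it, so \<open>P(X \<le> x) \<sim> x\<^sup>N / (N! \<Prod>\<lambda>)\<close> as \<open>x \<rightarrow> 0\<close>, and similarly
  for \<open>Y\<close>. Conditioning on \<open>X\<close>, the probability \<open>P(X Y \<le> t)\<close> is governed by the moment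
  \<open>E[X\<^sup>-\<^sup>N; X > t/r]\<close>, which a layer-cake integration shows to grow like \<open>ln (1/t) / ((N-1)! \<Prod>\<lambda>)\<close>.
  Finally \<open>\<gamma>\<^sub>I = p q / (p + q + 1)\<close> with \<open>p\<close> proportional to \<open>\<rho> X Y\<close> and \<open>q\<close> to \<open>\<rho> X\<close>. It is at most \<open>p\<close>, and
  close to \<open>p\<close> unless \<open>q\<close> stays bounded, an event of probability \<open>O(\<rho>\<^sup>-\<^sup>N) = o(\<rho>\<^sup>-\<^sup>N ln \<rho>)\<close>.
\<close>

section \<open>Square roots of Hermitian matrices with distinct eigenvalues\<close>

text \<open>The real inner product of the type \<open>complex^'n\<close> is only the real part of
  this form; orthogonality of eigenvectors over the complex numbers needs the full value.\<close>

definition cinner :: "complex^'n \<Rightarrow> complex^'n \<Rightarrow> complex" where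
  "cinner x y = (\<Sum>i\<in>UNIV. cnj (x $ i) * y $ i)"

definition diag_mat :: "('n \<Rightarrow> complex) \<Rightarrow> complex^'n^'n" where
  "diag_mat d = (\<chi> i j. if i = j then d i else 0)"

lemma adjoint_mat_mult: "adjoint_mat (A ** B) = adjoint_mat B ** adjoint_mat A"
  by (simp add: adjoint_mat_def matrix_matrix_mult_def vec_eq_iff mult.commute)

lemma adjoint_mat_adjoint_mat [simp]: "adjoint_mat (adjoint_mat A) = A"
  by (simp add: adjoint_mat_def vec_eq_iff)

lemma cinner_adjoint: "cinner (A *v x) y = cinner x (adjoint_mat A *v y)"
proof -
  have "cinner (A *v x) y = (\<Sum>i\<in>UNIV. \<Sum>j\<in>UNIV. cnj (A $ i $ j) * cnj (x $ j) * y $ i)"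
    by (simp add: cinner_def matrix_vector_mult_def sum_distrib_right)
  also have "\<dots> = (\<Sum>j\<in>UNIV. \<Sum>i\<in>UNIV. cnj (A $ i $ j) * cnj (x $ j) * y $ i)"
    by (rule sum.swap)
  also have "\<dots> = cinner x (adjoint_mat A *v y)"
    by (simp add: cinner_def matrix_vector_mult_def adjoint_mat_def sum_distrib_left mult_ac)
  finally show ?thesis .
qed

lemma norm_vec_complex_sq: "(norm (x :: complex^'n))\<^sup>2 = (\<Sum>i\<in>UNIV. (cmod (x $ i))\<^sup>2)"
  by (simp add: norm_vec_def L2_set_def sum_nonneg)

lemma cinner_self: "cinner x x = of_real ((norm x)\<^sup>2)"
  by (simp add: cinner_def norm_vec_complex_sq complex_norm_square[symmetric] mult.commute del: of_real_power)

lemma cinner_scale_right: "cinner x (c *s y) = c * cinner x y"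
  by (simp add: cinner_def sum_distrib_left mult_ac)

lemma cinner_scale_left: "cinner (c *s x) y = cnj c * cinner x y"
  by (simp add: cinner_def sum_distrib_left mult_ac)

lemma diag_mat_mult_vec: "diag_mat d *v x = (\<chi> i. d i * x $ i)"
  by (simp add: diag_mat_def matrix_vector_mult_def vec_eq_iff if_distrib[where f = "\<lambda>y. y * _"] cong: if_cong)

lemma diag_mat_mult: "diag_mat d ** diag_mat e = diag_mat (\<lambda>i. d i * e i)"
  by (auto simp: diag_mat_def matrix_matrix_mult_def vec_eq_iff if_distrib[where f = "\<lambda>y. y * _"] if_distrib[where f = "\<lambda>y. _ * y"] cong: if_cong)

lemma mult_diag_mat_nth: "(A ** diag_mat d) $ i $ j = A $ i $ j * d j"
  by (simp add: diag_mat_def matrix_matrix_mult_def if_distrib[where f = "\<lambda>y. _ * y"] cong: if_cong)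

lemma diag_mat_mult_nth: "(diag_mat d ** A) $ i $ j = d i * A $ i $ j"
  by (simp add: diag_mat_def matrix_matrix_mult_def if_distrib[where f = "\<lambda>y. y * _"] cong: if_cong)

section \<open>Diagonalization and the positive semidefinite square root\<close>

text \<open>Eigenvectors of a Hermitian matrix for different eigenvalues are orthogonal, so one
  normalized eigenvector for each of the \<open>CARD('n)\<close> distinct eigenvalues already fills
  the columns of a unitary matrix.\<close>

lemma hermitian_distinct_eigenvalues_diagonalizable:
  fixes R :: "complex^'n^'n" and lam :: "'n \<Rightarrow> real"
  assumes R: "hermitian R" and eig: "\<And>i. is_eigenvalue R (of_real (lam i))" and inj: "inj lam"
  obtains U where "adjoint_mat U ** U = mat 1" "U ** adjoint_mat U = mat 1"
    "R = U ** diag_mat (\<lambda>i. of_real (lam i)) ** adjoint_mat U"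
proof -
  have "\<exists>w. cinner w w = 1 \<and> R *v w = of_real (lam i) *s w" for i
  proof -
    obtain v where v: "v \<noteq> 0" "R *v v = of_real (lam i) *s v"
      using eig[of i] by (auto simp: is_eigenvalue_def)
    define w where "w = of_real (1 / norm v) *s v"
    have "cinner w w = cnj (of_real (1 / norm v)) * (of_real (1 / norm v) * of_real ((norm v)\<^sup>2))"
      unfolding w_def by (subst cinner_scale_left, subst cinner_scale_right, subst cinner_self) (rule refl)
    then have "cinner w w = 1" using v(1) by (simp add: power2_eq_square)
    moreover have "R *v w = of_real (lam i) *s w"
      using v(2) by (simp add: w_def vector_scalar_commute mult.commute)
    ultimately show ?thesis by blast
  qed
  then obtain v where v: "\<And>i. cinner (v i) (v i) = 1" "\<And>i. R *v v i = of_real (lam i) *s v i"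
    by metis
  have orth: "cinner (v i) (v j) = (if i = j then 1 else 0)" for i j
  proof (cases "i = j")
    case False
    \<comment> \<open>Moving \<open>R\<close> across the inner product yields \<open>lam j\<close>
      and \<open>lam i\<close> times the same number; the conjugation on the left argument is
      harmless because \<open>lam i\<close> is real.\<close>
    have "of_real (lam j) * cinner (v i) (v j) = cinner (v i) (R *v v j)" by (simp add: v cinner_scale_right)
    also have "\<dots> = cinner (R *v v i) (v j)" using R by (simp add: cinner_adjoint hermitian_def)
    also have "\<dots> = of_real (lam i) * cinner (v i) (v j)" by (simp add: v cinner_scale_left)
    finally show ?thesis using False inj by (auto dest: injD)
  qed (simp add: v)
  define U :: "complex^'n^'n" where "U = (\<chi> k i. v i $ k)"
  have U1: "adjoint_mat U ** U = mat 1"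
    using orth by (simp add: vec_eq_iff matrix_matrix_mult_def adjoint_mat_def U_def mat_def cinner_def)
  then have U2: "U ** adjoint_mat U = mat 1" using matrix_left_right_inverse by blast
  have RU: "R ** U = U ** diag_mat (\<lambda>i. of_real (lam i))"
  proof -
    have "(R ** U) $ k $ i = (R *v v i) $ k" for k i
      by (simp add: matrix_matrix_mult_def matrix_vector_mult_def U_def)
    then show ?thesis by (simp add: vec_eq_iff mult_diag_mat_nth v U_def)
  qed
  have "R = R ** (U ** adjoint_mat U)" by (simp add: U2)
  also have "\<dots> = U ** diag_mat (\<lambda>i. of_real (lam i)) ** adjoint_mat U"
    by (simp add: matrix_mul_assoc RU)
  finally show thesis using that U1 U2 by blast
qed

text \<open>\<open>msqrt\<close> is a definite description, so both existence and uniqueness are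
  required. Existence takes square roots on the diagonal. For uniqueness, any root commutes with its
  own square, hence is diagonal in the eigenbasis, and semidefiniteness fixes the signs.\<close>

lemma msqrt_unitary_diag:
  fixes U :: "complex^'n^'n" and lam :: "'n \<Rightarrow> real"
  assumes U: "adjoint_mat U ** U = mat 1" "U ** adjoint_mat U = mat 1"
    and pos: "\<And>i. lam i > 0" and inj: "inj lam"
  shows "msqrt (U ** diag_mat (\<lambda>i. of_real (lam i)) ** adjoint_mat U) =
    U ** diag_mat (\<lambda>i. of_real (sqrt (lam i))) ** adjoint_mat U" (is "msqrt ?R = ?S")
  unfolding msqrt_def
proof (rule the_equality)
  have canc: "(A ** adjoint_mat U) ** (U ** B) = A ** B" for A B :: "complex^'n^'n"
    by (metis U(1) matrix_mul_assoc matrix_mul_rid)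
  have "adjoint_mat (diag_mat (\<lambda>i. of_real (sqrt (lam i)))) = diag_mat (\<lambda>i::'n. of_real (sqrt (lam i)))"
    by (auto simp: adjoint_mat_def diag_mat_def vec_eq_iff)
  then have "hermitian ?S" by (simp add: hermitian_def adjoint_mat_mult matrix_mul_assoc)
  moreover have "Re (herm_form ?S x) \<ge> 0" for x
  proof -
    have "herm_form ?S x = cinner (adjoint_mat U *v x) (diag_mat (\<lambda>i. of_real (sqrt (lam i))) *v (adjoint_mat U *v x))"
      by (simp add: cinner_adjoint) (simp add: herm_form_def cinner_def matrix_vector_mul_assoc matrix_mul_assoc)
    also have "\<dots> = (\<Sum>i\<in>UNIV. of_real (sqrt (lam i) * (cmod ((adjoint_mat U *v x) $ i))\<^sup>2))"
      by (simp add: cinner_def diag_mat_mult_vec complex_norm_square[symmetric] mult_ac del: of_real_power)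
    finally show ?thesis using pos by (simp add: sum_nonneg less_imp_le)
  qed
  moreover have "?S ** ?S = ?R"
  proof -
    have "?S ** ?S = (U ** diag_mat (\<lambda>i. of_real (sqrt (lam i))) ** adjoint_mat U) ** (U ** (diag_mat (\<lambda>i. of_real (sqrt (lam i))) ** adjoint_mat U))"
      by (simp add: matrix_mul_assoc)
    also have "\<dots> = U ** (diag_mat (\<lambda>i. of_real (sqrt (lam i))) ** diag_mat (\<lambda>i. of_real (sqrt (lam i)))) ** adjoint_mat U"
      unfolding canc by (simp add: matrix_mul_assoc)
    also have "\<dots> = ?R" unfolding diag_mat_mult using pos
      by (simp add: of_real_mult[symmetric] less_imp_le del: of_real_mult)
    finally show ?thesis .
  qed
  ultimately show "pos_semidef ?S \<and> ?S ** ?S = ?R" by (simp add: pos_semidef_def)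
next
  fix S assume S: "pos_semidef S \<and> S ** S = U ** diag_mat (\<lambda>i. of_real (lam i)) ** adjoint_mat U"
  define T where "T = adjoint_mat U ** S ** U"
  have T2: "T ** T = diag_mat (\<lambda>i. of_real (lam i))"
  proof -
    have "T ** T = adjoint_mat U ** (S ** (U ** adjoint_mat U) ** S) ** U"
      by (simp add: T_def matrix_mul_assoc)
    also have "\<dots> = adjoint_mat U ** (S ** S) ** U" by (simp add: U)
    also have "\<dots> = (adjoint_mat U ** U) ** diag_mat (\<lambda>i. of_real (lam i)) ** (adjoint_mat U ** U)"
      using S by (simp add: matrix_mul_assoc)
    finally show ?thesis by (simp add: U)
  qed
  \<comment> \<open>\<open>T\<close> commutes with \<open>T ** T\<close>, a diagonal matrix with
    distinct entries; this forces the off-diagonal entries to vanish.\<close>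
  have off: "T $ i $ j = 0" if "i \<noteq> j" for i j
  proof -
    have "(T ** diag_mat (\<lambda>i. of_real (lam i))) $ i $ j = (diag_mat (\<lambda>i. of_real (lam i)) ** T) $ i $ j"
      unfolding T2[symmetric] by (simp add: matrix_mul_assoc)
    then have "T $ i $ j * of_real (lam j) = of_real (lam i) * T $ i $ j"
      unfolding mult_diag_mat_nth diag_mat_mult_nth .
    then show ?thesis using that inj by (auto dest: injD)
  qed
  have T: "T = diag_mat (\<lambda>i. T $ i $ i)"
    using off by (auto simp: vec_eq_iff diag_mat_def)
  have "T $ i $ i = of_real (sqrt (lam i))" for i
  proof -
    have "diag_mat (\<lambda>i. T $ i $ i * T $ i $ i) = diag_mat (\<lambda>i. of_real (lam i))"
      using T2 T by (metis diag_mat_mult)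
    then have "diag_mat (\<lambda>i. T $ i $ i * T $ i $ i) $ i $ i = diag_mat (\<lambda>i. of_real (lam i)) $ i $ i" by simp
    then have sq: "(T $ i $ i)\<^sup>2 = (of_real (sqrt (lam i)))\<^sup>2"
      using pos[of i] by (simp add: diag_mat_def power2_eq_square of_real_mult[symmetric] del: of_real_mult)
    \<comment> \<open>The diagonal entry is the quadratic form of \<open>S\<close> at column
      \<open>i\<close> of \<open>U\<close>, so its real part is nonnegative and the negative root is
      excluded.\<close>
    have "T $ i $ i = herm_form S (\<chi> k. U $ k $ i)"
      unfolding T_def matrix_mul_assoc[symmetric] herm_form_def
      by (simp add: matrix_matrix_mult_def matrix_vector_mult_def adjoint_mat_def)
    then have "Re (T $ i $ i) \<ge> 0" using S by (simp add: pos_semidef_def)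
    moreover have "T $ i $ i = of_real (sqrt (lam i)) \<or> T $ i $ i = - of_real (sqrt (lam i))"
      using sq by (simp only: power2_eq_iff)
    ultimately show ?thesis using pos[of i] by (auto simp: complex_eq_iff)
  qed
  with T have "T = diag_mat (\<lambda>i. of_real (sqrt (lam i)))" by (simp add: diag_mat_def vec_eq_iff)
  moreover have "S = U ** T ** adjoint_mat U"
  proof -
    have "U ** T ** adjoint_mat U = (U ** adjoint_mat U) ** S ** (U ** adjoint_mat U)"
      by (simp add: T_def matrix_mul_assoc)
    then show ?thesis by (simp add: U)
  qed
  ultimately show "S = ?S" by simp
qed

lemma orthogonal_transformation_unitary:
  fixes U :: "complex^'n^'n"
  assumes "U ** adjoint_mat U = mat 1"
  shows "orthogonal_transformation (\<lambda>z. adjoint_mat U *v z)"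
  unfolding orthogonal_transformation
proof safe
  show "linear (\<lambda>z. adjoint_mat U *v z)"
    by (rule linearI) (simp_all add: vec_eq_iff matrix_vector_mult_def distrib_left sum.distrib scaleR_sum_right)
  fix z
  have "complex_of_real ((norm (adjoint_mat U *v z))\<^sup>2) = of_real ((norm z)\<^sup>2)"
    unfolding cinner_self[symmetric] by (simp add: cinner_adjoint matrix_vector_mul_assoc assms)
  then show "norm (adjoint_mat U *v z) = norm z" by (simp only: of_real_eq_iff) simp
qed

text \<open>In \<open>U ** diag_mat d ** adjoint_mat U\<close> the left factor preserves norms and
  drops out, which leaves a diagonal form in the rotated vector. Only the fact that \<open>g\<close>
  is a real orthogonal map matters later, since such maps preserve Lebesgue measure.\<close>

lemma norm_msqrt_mult_vec:
  fixes R :: "complex^'n^'n" and lam :: "'n \<Rightarrow> real"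
  assumes R: "hermitian R" and eig: "\<And>i. is_eigenvalue R (of_real (lam i))"
    and pos: "\<And>i. lam i > 0" and inj: "inj lam"
  shows "\<exists>g. orthogonal_transformation g \<and>
      (\<forall>z. (norm (msqrt R *v z))\<^sup>2 = (\<Sum>i\<in>UNIV. lam i * (cmod (g z $ i))\<^sup>2))" (is ?A)
    and "\<exists>g. orthogonal_transformation g \<and>
      (\<forall>z. (norm (z v* msqrt R))\<^sup>2 = (\<Sum>i\<in>UNIV. lam i * (cmod (g z $ i))\<^sup>2))" (is ?B)
proof -
  obtain U where U: "adjoint_mat U ** U = mat 1" "U ** adjoint_mat U = mat 1"
    and RU: "R = U ** diag_mat (\<lambda>i. of_real (lam i)) ** adjoint_mat U"
    using hermitian_distinct_eigenvalues_diagonalizable[OF R eig inj] by blast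
  define d :: "'n \<Rightarrow> complex" where "d = (\<lambda>i. of_real (sqrt (lam i)))"
  have S: "msqrt R = U ** diag_mat d ** adjoint_mat U"
    unfolding RU d_def by (rule msqrt_unitary_diag[OF U pos inj])
  have isoU: "norm (U *v z) = norm z" for z
    using orthogonal_transformation_unitary[of "adjoint_mat U"] U by (simp add: orthogonal_transformation)
  have nrm: "(norm (msqrt R *v z))\<^sup>2 = (\<Sum>i\<in>UNIV. lam i * (cmod ((adjoint_mat U *v z) $ i))\<^sup>2)" for z
  proof -
    have "norm (msqrt R *v z) = norm (diag_mat d *v (adjoint_mat U *v z))"
      unfolding S by (metis isoU matrix_vector_mul_assoc matrix_mul_assoc)
    then show ?thesis
      using pos by (simp add: norm_vec_complex_sq diag_mat_mult_vec norm_mult power_mult_distrib d_def less_imp_le)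
  qed
  then show ?A using orthogonal_transformation_unitary[OF U(2)] by blast
  \<comment> \<open>Entrywise conjugation is a real-linear isometry, although not complex linear.
    For the Hermitian matrix \<open>msqrt R\<close> it turns a row vector times the matrix into the
    matrix times a column vector, up to conjugation.\<close>
  define cj :: "complex^'n \<Rightarrow> complex^'n" where "cj z = (\<chi> i. cnj (z $ i))" for z
  have cj: "orthogonal_transformation cj"
    unfolding orthogonal_transformation
    by (auto intro!: linearI simp: cj_def vec_eq_iff norm_vec_def L2_set_def)
  have herm: "adjoint_mat (msqrt R) = msqrt R"
  proof -
    have "adjoint_mat (diag_mat d) = diag_mat d"
      by (auto simp: adjoint_mat_def diag_mat_def vec_eq_iff d_def)
    then show ?thesis by (simp add: S adjoint_mat_mult matrix_mul_assoc)
  qed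
  have "(norm (z v* msqrt R))\<^sup>2 = (norm (msqrt R *v cj z))\<^sup>2" for z
  proof -
    have "(z v* msqrt R) $ j = cnj ((msqrt R *v cj z) $ j)" for j
      by (subst herm[symmetric])
        (simp add: vector_matrix_mult_def matrix_vector_mult_def adjoint_mat_def cj_def mult.commute)
    then show ?thesis by (simp add: norm_vec_def L2_set_def)
  qed
  then have "(norm (z v* msqrt R))\<^sup>2 = (\<Sum>i\<in>UNIV. lam i * (cmod ((((\<lambda>z. adjoint_mat U *v z) \<circ> cj) z) $ i))\<^sup>2)" for z
    by (simp add: nrm)
  then show ?B
    using orthogonal_transformation_compose[OF orthogonal_transformation_unitary[OF U(2)] cj] by blast
qed

section \<open>Small balls for Gaussian quadratic forms\<close>

lemma nn_integral_lborel_translate: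
  fixes f :: "'a::euclidean_space \<Rightarrow> ennreal"
  assumes [measurable]: "f \<in> borel_measurable borel"
  shows "(\<integral>\<^sup>+x. f (x + c) \<partial>lborel) = (\<integral>\<^sup>+x. f x \<partial>lborel)"
proof -
  have "(\<integral>\<^sup>+x. f x \<partial>lborel) = (\<integral>\<^sup>+x. f x \<partial>distr lborel borel ((+) c))" by (simp add: lborel_distr_plus)
  also have "\<dots> = (\<integral>\<^sup>+x. f (x + c) \<partial>lborel)" by (subst nn_integral_distr) (auto simp: add.commute)
  finally show ?thesis ..
qed

lemma nn_integral_lborel_reflect:
  fixes f :: "'a::euclidean_space \<Rightarrow> ennreal"
  assumes [measurable]: "f \<in> borel_measurable borel"
  shows "(\<integral>\<^sup>+x. f (c - x) \<partial>lborel) = (\<integral>\<^sup>+x. f x \<partial>lborel)"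
proof -
  have "lborel = distr lborel borel (\<lambda>x::'a. c - x)"
    using lborel_affine[of "-1" c] by (simp add: density_1)
  then have "(\<integral>\<^sup>+x. f x \<partial>lborel) = (\<integral>\<^sup>+x. f x \<partial>distr lborel borel (\<lambda>x. c - x))" by simp
  also have "\<dots> = (\<integral>\<^sup>+x. f (c - x) \<partial>lborel)" by (subst nn_integral_distr) auto
  finally show ?thesis ..
qed

text \<open>The image measure is translation invariant, and comparing the two orders of integration of
  \<open>1\<^sub>A (f x) * 1\<^sub>B (f x + y)\<close> shows that it is proportional to Lebesgue measure; the factor is read
  off from the unit ball.\<close>
lemma lborel_distr_orthogonal_transformation:
  fixes f :: "'a::euclidean_space \<Rightarrow> 'a"
  assumes f: "orthogonal_transformation f"
  shows "distr lborel borel f = lborel"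
proof (rule measure_eqI)
  have lin: "linear f" using f by (rule orthogonal_transformation_linear)
  then have [measurable]: "f \<in> borel_measurable borel"
    by (intro borel_measurable_continuous_onI linear_continuous_on) (simp add: linear_conv_bounded_linear)
  show "sets (distr lborel borel f) = sets lborel" by simp
  fix A assume "A \<in> sets (distr lborel borel f)"
  then have [measurable]: "A \<in> sets borel" by simp
  define B :: "'a set" where "B = ball 0 1"
  have [measurable]: "B \<in> sets borel" by (simp add: B_def)
  have "inv f \<in> borel_measurable borel" if "linear (inv f)"
    using that by (intro borel_measurable_continuous_onI linear_continuous_on) (simp add: linear_conv_bounded_linear)
  then have [measurable]: "inv f \<in> borel_measurable borel"
    using orthogonal_transformation_inv[OF f] orthogonal_transformation_linear by blast
  have finv: "f (x + inv f y) = f x + y" for x y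
    using lin orthogonal_transformation_surj[OF f] by (simp add: linear_add surj_f_inv_f)
  have muA: "emeasure (distr lborel borel f) S = (\<integral>\<^sup>+x. indicator S (f x) \<partial>lborel)" if "S \<in> sets borel" for S
    using that by (subst nn_integral_indicator[symmetric]) (simp, subst nn_integral_distr, auto)
  have "emeasure (distr lborel borel f) A * emeasure lborel B
      = (\<integral>\<^sup>+x. indicator A (f x) * emeasure lborel B \<partial>lborel)"
    by (simp add: muA nn_integral_multc)
  also have "\<dots> = (\<integral>\<^sup>+x. indicator A (f x) * (\<integral>\<^sup>+y. indicator B (y + f x) \<partial>lborel) \<partial>lborel)"
    by (subst nn_integral_lborel_translate) auto
  also have "\<dots> = (\<integral>\<^sup>+x. (\<integral>\<^sup>+y. indicator A (f x) * indicator B (y + f x) \<partial>lborel) \<partial>lborel)"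
    by (simp add: nn_integral_cmult)
  also have "\<dots> = (\<integral>\<^sup>+y. (\<integral>\<^sup>+x. indicator A (f x) * indicator B (y + f x) \<partial>lborel) \<partial>lborel)"
    by (rule lborel_pair.Fubini') simp
  \<comment> \<open>Shifting \<open>x\<close> by \<open>inv f (- y)\<close> replaces
    \<open>f x\<close> by \<open>f x - y\<close>, so that \<open>y\<close> moves from the ball
    factor to the factor of \<open>A\<close>.\<close>
  also have "\<dots> = (\<integral>\<^sup>+y. (\<integral>\<^sup>+x. indicator A (f (x + inv f (- y))) * indicator B (y + f (x + inv f (- y))) \<partial>lborel) \<partial>lborel)"
    by (subst nn_integral_lborel_translate[where f = "\<lambda>x. indicator A (f x) * indicator B (_ + f x)"]) auto
  also have "\<dots> = (\<integral>\<^sup>+y. (\<integral>\<^sup>+x. indicator A (f x - y) * indicator B (f x) \<partial>lborel) \<partial>lborel)"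
    by (simp add: finv)
  also have "\<dots> = (\<integral>\<^sup>+x. (\<integral>\<^sup>+y. indicator A (f x - y) * indicator B (f x) \<partial>lborel) \<partial>lborel)"
    by (rule lborel_pair.Fubini') simp
  also have "\<dots> = (\<integral>\<^sup>+x. emeasure lborel A * indicator B (f x) \<partial>lborel)"
    by (simp add: nn_integral_multc nn_integral_lborel_reflect[where f = "indicator A"])
  also have "\<dots> = emeasure lborel A * emeasure (distr lborel borel f) B"
    by (simp add: nn_integral_cmult muA)
  \<comment> \<open>An orthogonal map leaves the unit ball invariant, so both measures agree on it;
    its volume is positive and finite and can be cancelled.\<close>
  also have "emeasure (distr lborel borel f) B = emeasure lborel B"
  proof -
    have "f -` B = B" using f by (auto simp: B_def orthogonal_transformation)
    then show ?thesis by (simp add: emeasure_distr)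
  qed
  finally have eq: "emeasure (distr lborel borel f) A * emeasure lborel B = emeasure lborel A * emeasure lborel B" .
  have "emeasure lborel B \<noteq> 0" "emeasure lborel B \<noteq> \<top>"
    unfolding B_def using emeasure_ball[of 1 "0::'a"] unit_ball_vol_pos[of "real DIM('a)"]
    by (auto simp: ennreal_eq_0_iff simp del: unit_ball_vol_pos)
  then show "emeasure (distr lborel borel f) A = emeasure lborel A"
    using eq by (metis ennreal_mult_divide_eq)
qed

lemma emeasure_lborel_orthogonal_preimage:
  fixes f :: "'a::euclidean_space \<Rightarrow> 'a"
  assumes f: "orthogonal_transformation f" and S: "S \<in> sets borel"
  shows "emeasure lborel (f -` S) = emeasure lborel S"
proof -
  have [measurable]: "f \<in> borel_measurable borel"
    using orthogonal_transformation_linear[OF f]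
    by (intro borel_measurable_continuous_onI linear_continuous_on) (simp add: linear_conv_bounded_linear)
  have "emeasure lborel S = emeasure (distr lborel borel f) S"
    by (simp add: lborel_distr_orthogonal_transformation[OF f])
  then show ?thesis using S by (simp add: emeasure_distr)
qed

section \<open>The law of a complex Gaussian vector\<close>

lemma borel_measurable_vec_lambda:
  fixes f :: "'b \<Rightarrow> 'n::finite \<Rightarrow> 'a::euclidean_space"
  assumes [measurable]: "\<And>k. (\<lambda>x. f x k) \<in> borel_measurable M"
  shows "(\<lambda>x. \<chi> k. f x k) \<in> borel_measurable M"
proof (subst borel_measurable_euclidean_space, safe)
  fix b :: "'a^'n" assume "b \<in> Basis"
  show "(\<lambda>x. (\<chi> k. f x k) \<bullet> b) \<in> borel_measurable M"
    unfolding inner_vec_def by simp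
qed

lemma borel_measurable_vec_nth [measurable]:
  "(\<lambda>z :: 'a::euclidean_space^'n. z $ k) \<in> borel_measurable borel"
  by (intro borel_measurable_continuous_onI continuous_intros)

lemma prod_Basis_vec:
  "(\<Prod>b\<in>(Basis :: ('a::euclidean_space^'n) set). h b) = (\<Prod>k\<in>UNIV. \<Prod>b\<in>Basis. h (axis k b))"
proof -
  have "(Basis :: ('a^'n) set) = (\<lambda>(k, b). axis k b) ` (UNIV \<times> Basis)"
    by (auto simp: Basis_vec_def)
  moreover have "inj_on (\<lambda>(k, b). axis k b :: 'a^'n) (UNIV \<times> Basis)"
    by (auto simp: inj_on_def axis_eq_axis)
  ultimately have "(\<Prod>b\<in>(Basis :: ('a^'n) set). h b) = (\<Prod>p\<in>UNIV \<times> Basis. h ((\<lambda>(k, b). axis k b) p))"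
    by (metis (no_types, lifting) prod.reindex_cong)
  then show ?thesis by (simp add: prod.cartesian_product case_prod_unfold)
qed

text \<open>Lebesgue measure is determined by the volumes of boxes, and a box in
  \<open>'a^'n\<close> is the product of its coordinate boxes. This carries product laws of
  coordinates over to densities on vectors.\<close>

lemma lborel_vec_eq_distr_PiM:
  "(lborel :: ('a::euclidean_space^'n) measure) = distr (Pi\<^sub>M (UNIV :: 'n set) (\<lambda>_. lborel)) borel (\<lambda>f. \<chi> k. f k)"
proof (rule lborel_eqI)
  interpret product_sigma_finite "\<lambda>_::'n. lborel :: 'a measure" ..
  have [measurable]: "(\<lambda>f. \<chi> k. f k) \<in> borel_measurable (Pi\<^sub>M (UNIV :: 'n set) (\<lambda>_. lborel :: 'a measure))"
    by (rule borel_measurable_vec_lambda) simp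
  fix l u :: "'a^'n" assume le: "\<And>b. b \<in> Basis \<Longrightarrow> l \<bullet> b \<le> u \<bullet> b"
  have le': "l $ k \<bullet> b \<le> u $ k \<bullet> b" if "b \<in> Basis" for k b
    using le[of "axis k b"] that by (simp add: inner_axis)
  have box: "(\<lambda>f. \<chi> k. f k) -` box l u \<inter> space (Pi\<^sub>M UNIV (\<lambda>_. lborel)) = (\<Pi>\<^sub>E k\<in>UNIV. box (l $ k) (u $ k))"
    by (auto simp: mem_box Basis_vec_def inner_axis space_PiM PiE_iff)
  have "emeasure (distr (Pi\<^sub>M (UNIV :: 'n set) (\<lambda>_. lborel)) borel (\<lambda>f. \<chi> k. f k)) (box l u)
      = (\<Prod>k\<in>UNIV. emeasure lborel (box (l $ k) (u $ k)))"
    by (simp add: emeasure_distr box emeasure_PiM)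
  also have "\<dots> = (\<Prod>k\<in>UNIV. ennreal (\<Prod>b\<in>Basis. (u $ k - l $ k) \<bullet> b))"
    using le' by (simp add: emeasure_lborel_box)
  also have "\<dots> = ennreal (\<Prod>k\<in>UNIV. \<Prod>b\<in>Basis. (u $ k - l $ k) \<bullet> b)"
    using le' by (intro prod_ennreal prod_nonneg) (auto simp: inner_diff_left)
  also have "\<dots> = ennreal (\<Prod>b\<in>Basis. (u - l) \<bullet> b)"
    by (simp add: prod_Basis_vec inner_axis)
  finally show "emeasure (distr (Pi\<^sub>M (UNIV :: 'n set) (\<lambda>_. lborel)) borel (\<lambda>f. \<chi> k. f k)) (box l u) = (\<Prod>b\<in>Basis. (u - l) \<bullet> b)" .
qed simp

text \<open>A product measure is determined by its values on product sets. There the indicator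
  factorizes along with the density, and the integral of a product of functions of separate
  coordinates is the product of the integrals.\<close>

lemma (in product_sigma_finite) PiM_density:
  assumes I: "finite I" and f: "\<And>i. i \<in> I \<Longrightarrow> f i \<in> borel_measurable (M i)"
    and sf: "\<And>i. sigma_finite_measure (density (M i) (f i))"
  shows "Pi\<^sub>M I (\<lambda>i. density (M i) (f i)) = density (Pi\<^sub>M I M) (\<lambda>x. \<Prod>i\<in>I. f i (x i))"
proof -
  interpret D: product_sigma_finite "\<lambda>i. density (M i) (f i)" by (rule product_sigma_finite.intro) (rule sf)
  have meas: "(\<lambda>x. \<Prod>i\<in>I. f i (x i)) \<in> borel_measurable (Pi\<^sub>M I M)"
    using f by (intro borel_measurable_prod_ennreal) (simp add: measurable_compose[OF measurable_component_singleton])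
  show ?thesis
  proof (rule D.PiM_eqI[OF I, symmetric])
    show "sets (density (Pi\<^sub>M I M) (\<lambda>x. \<Prod>i\<in>I. f i (x i))) = sets (Pi\<^sub>M I (\<lambda>i. density (M i) (f i)))"
      by (simp cong: sets_PiM_cong)
    fix A assume "\<And>i. i \<in> I \<Longrightarrow> A i \<in> sets (density (M i) (f i))"
    then have A: "\<And>i. i \<in> I \<Longrightarrow> A i \<in> sets (M i)" by simp
    have "emeasure (density (Pi\<^sub>M I M) (\<lambda>x. \<Prod>i\<in>I. f i (x i))) (Pi\<^sub>E I A)
        = (\<integral>\<^sup>+x. (\<Prod>i\<in>I. f i (x i)) * indicator (Pi\<^sub>E I A) x \<partial>Pi\<^sub>M I M)"
      using A I by (intro emeasure_density meas) (auto intro: sets_PiM_I_finite)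
    also have "\<dots> = (\<integral>\<^sup>+x. (\<Prod>i\<in>I. f i (x i) * indicator (A i) (x i)) \<partial>Pi\<^sub>M I M)"
    proof (rule nn_integral_cong)
      fix x assume "x \<in> space (Pi\<^sub>M I M)"
      then have "indicator (Pi\<^sub>E I A) x = (\<Prod>i\<in>I. indicator (A i) (x i) :: ennreal)"
        using I by (auto simp: space_PiM PiE_def Pi_def indicator_def prod_zero_iff)
      then show "(\<Prod>i\<in>I. f i (x i)) * indicator (Pi\<^sub>E I A) x = (\<Prod>i\<in>I. f i (x i) * indicator (A i) (x i))"
        by (simp add: prod.distrib)
    qed
    also have "\<dots> = (\<Prod>i\<in>I. \<integral>\<^sup>+x. f i x * indicator (A i) x \<partial>M i)"
      using A f by (intro product_nn_integral_prod I) auto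
    also have "\<dots> = (\<Prod>i\<in>I. emeasure (density (M i) (f i)) (A i))"
      using A f by (intro prod.cong) (auto simp: emeasure_density)
    finally show "emeasure (density (Pi\<^sub>M I M) (\<lambda>x. \<Prod>i\<in>I. f i (x i))) (Pi\<^sub>E I A) = (\<Prod>i\<in>I. emeasure (density (M i) (f i)) (A i))" .
  qed
qed

lemma prod_cn_density:
  fixes z :: "complex^'n"
  shows "(\<Prod>k\<in>UNIV. cn_density (z $ k)) = ennreal (exp (- (norm z)\<^sup>2) / pi ^ CARD('n))"
proof -
  have "(\<Prod>k\<in>UNIV. cn_density (z $ k)) = ennreal (\<Prod>k\<in>UNIV. exp (- (cmod (z $ k))\<^sup>2) / pi)"
    unfolding cn_density_def by (rule prod_ennreal) simp
  also have "(\<Prod>k\<in>UNIV. exp (- (cmod (z $ k))\<^sup>2) / pi) = exp (- (norm z)\<^sup>2) / pi ^ CARD('n)"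
    by (simp add: prod_dividef norm_vec_def L2_set_def sum_nonneg exp_sum[symmetric] sum_negf)
  finally show ?thesis .
qed

text \<open>Independence makes the law of the family of entries a product measure; its density is
  the product of the entry densities, which depends on the norm only.\<close>

lemma (in prob_space) distr_complex_gaussian_vector:
  fixes h :: "'a \<Rightarrow> complex^'n"
  assumes dens: "\<And>k. distributed M lborel (\<lambda>\<omega>. h \<omega> $ k) cn_density"
    and indep: "indep_vars (\<lambda>_. borel) (\<lambda>k \<omega>. h \<omega> $ k) UNIV"
  shows "distr M borel h = density lborel (\<lambda>z. ennreal (exp (- (norm z)\<^sup>2) / pi ^ CARD('n)))"
proof -
  interpret product_sigma_finite "\<lambda>_::'n. lborel :: complex measure" ..
  have [measurable]: "cn_density \<in> borel_measurable borel" unfolding cn_density_def by measurable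
  have rv[measurable]: "random_variable borel (\<lambda>\<omega>. h \<omega> $ k)" for k
    using distributed_measurable[OF dens[of k]] by simp
  have V[measurable]: "(\<lambda>f. \<chi> k. f k) \<in> borel_measurable (Pi\<^sub>M (UNIV :: 'n set) (\<lambda>_. borel :: complex measure))"
    by (rule borel_measurable_vec_lambda) simp
  have V'[measurable]: "(\<lambda>f. \<chi> k. f k) \<in> borel_measurable (Pi\<^sub>M (UNIV :: 'n set) (\<lambda>_. lborel :: complex measure))"
    by (rule borel_measurable_vec_lambda) simp
  have d: "distr M borel (\<lambda>\<omega>. h \<omega> $ k) = density lborel cn_density" for k
    using distributed_distr_eq_density[OF dens[of k]] by (metis distr_cong sets_lborel)
  \<comment> \<open>This measure is the law of an entry, hence a probability measure;
    \<open>undefined\<close> stands for an arbitrary coordinate.\<close>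
  have sf: "sigma_finite_measure (density lborel cn_density)"
    using prob_space_distr[OF rv, of undefined] unfolding d
    by (intro prob_space_imp_sigma_finite)
  have "distr M borel h = distr M borel ((\<lambda>f. \<chi> k. f k) \<circ> (\<lambda>\<omega>. \<lambda>k\<in>UNIV. h \<omega> $ k))"
    by (simp add: comp_def restrict_UNIV)
  also have "\<dots> = distr (distr M (Pi\<^sub>M UNIV (\<lambda>_. borel)) (\<lambda>\<omega>. \<lambda>k\<in>UNIV. h \<omega> $ k)) borel (\<lambda>f. \<chi> k. f k)"
    by (rule distr_distr[symmetric]) measurable
  also have "distr M (Pi\<^sub>M UNIV (\<lambda>_. borel)) (\<lambda>\<omega>. \<lambda>k\<in>UNIV. h \<omega> $ k) = Pi\<^sub>M UNIV (\<lambda>_. density lborel cn_density)"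
    using indep_vars_iff_distr_eq_PiM[where I = UNIV and M' = "\<lambda>_. borel" and X = "\<lambda>k \<omega>. h \<omega> $ k"] indep rv by (simp add: d)
  also have "\<dots> = density (Pi\<^sub>M UNIV (\<lambda>_. lborel)) (\<lambda>f. \<Prod>k\<in>UNIV. cn_density (f k))"
    by (rule PiM_density) (auto simp: sf)
  \<comment> \<open>The density is rewritten as a function of the vector, so that it can pass
    through the image under \<open>\<chi>\<close>.\<close>
  also have "\<dots> = density (Pi\<^sub>M UNIV (\<lambda>_. lborel)) (\<lambda>f. (\<lambda>z. \<Prod>k\<in>UNIV. cn_density (z $ k)) (\<chi> k. f k))"
    by simp
  also have "distr \<dots> borel (\<lambda>f. \<chi> k. f k) = density lborel (\<lambda>z. \<Prod>k\<in>UNIV. cn_density (z $ k))"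
    unfolding lborel_vec_eq_distr_PiM by (rule density_distr[symmetric]) measurable
  finally show ?thesis by (simp add: prod_cn_density)
qed

section \<open>Ellipsoid volumes and the small-ball limit\<close>

text \<open>Scaling coordinate \<open>i\<close> by \<open>1 / sqrt (lam i)\<close> maps the ball of
  radius \<open>sqrt x\<close> onto the ellipsoid. Each complex coordinate counts as two real ones,
  so the scaling contributes \<open>1 / lam i\<close>, and the ball has real dimension
  \<open>2 * CARD('n)\<close>.\<close>

lemma emeasure_lborel_complex_ellipsoid:
  fixes lam :: "'n::finite \<Rightarrow> real"
  assumes pos: "\<And>i. lam i > 0" and x: "x > 0"
  shows "emeasure lborel {z :: complex^'n. (\<Sum>i\<in>UNIV. lam i * (cmod (z $ i))\<^sup>2) \<le> x}
    = ennreal (pi ^ CARD('n) * x ^ CARD('n) / (fact CARD('n) * (\<Prod>i\<in>UNIV. lam i)))"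
proof -
  define E where "E = {z :: complex^'n. (\<Sum>i\<in>UNIV. lam i * (cmod (z $ i))\<^sup>2) \<le> x}"
  have [measurable]: "E \<in> sets borel" unfolding E_def by measurable
  \<comment> \<open>Scaling factors must be indexed by real basis vectors. At
    \<open>axis k b\<close> all summands but one vanish, and the value is
    \<open>1 / sqrt (lam k)\<close>.\<close>
  define c where "c j = (\<Sum>i\<in>UNIV. cmod (j $ i) / sqrt (lam i))" for j :: "complex^'n"
  have c_axis: "c (axis k b) = 1 / sqrt (lam k)" if "b \<in> Basis" for k b
  proof -
    have "c (axis k b) = (\<Sum>i\<in>UNIV. if i = k then 1 / sqrt (lam k) else 0)"
      unfolding c_def using that by (intro sum.cong) (auto simp: axis_def norm_Basis)
    then show ?thesis by simp
  qed
  define T where "T w = (\<Sum>j\<in>Basis. (c j * (w \<bullet> j)) *\<^sub>R j)" for w :: "complex^'n"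
  have T: "T w $ k = (1 / sqrt (lam k)) *\<^sub>R (w $ k)" for w k
  proof (rule euclidean_eqI)
    fix b :: complex assume b: "b \<in> Basis"
    have "T w $ k \<bullet> b = T w \<bullet> axis k b" by (simp add: inner_axis)
    also have "\<dots> = c (axis k b) * (w \<bullet> axis k b)"
      unfolding T_def using b by (subst inner_sum_left_Basis) auto
    finally show "T w $ k \<bullet> b = ((1 / sqrt (lam k)) *\<^sub>R (w $ k)) \<bullet> b"
      using b by (simp add: c_axis inner_axis)
  qed
  have preE: "T -` E = cball 0 (sqrt x)"
  proof -
    have "(\<Sum>i\<in>UNIV. lam i * (cmod (T w $ i))\<^sup>2) = (norm w)\<^sup>2" for w
      using pos by (simp add: T power_mult_distrib power_divide less_imp_le norm_vec_def L2_set_def sum_nonneg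
          less_imp_neq[OF pos, symmetric])
    moreover have "norm w \<le> sqrt x \<longleftrightarrow> (norm w)\<^sup>2 \<le> x" for w :: "complex^'n"
      using real_sqrt_le_iff[of "(norm w)\<^sup>2" x] by simp
    ultimately show ?thesis by (auto simp: E_def)
  qed
  have cne: "c j \<noteq> 0" if "j \<in> Basis" for j
    using that c_axis pos by (force simp: Basis_vec_def less_imp_neq[OF pos, symmetric])
  have Tm[measurable]: "T \<in> borel_measurable borel" unfolding T_def by measurable
  have "(lborel :: (complex^'n) measure) = density (distr lborel borel T) (\<lambda>_. ennreal (\<Prod>j\<in>Basis. \<bar>c j\<bar>))"
    using lborel_affine_euclidean[of c 0, OF cne] by (simp add: T_def[abs_def])
  then have "emeasure lborel E = emeasure (density (distr lborel borel T) (\<lambda>_. ennreal (\<Prod>j\<in>Basis. \<bar>c j\<bar>))) E"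
    by metis
  also have "\<dots> = ennreal (\<Prod>j\<in>Basis. \<bar>c j\<bar>) * emeasure (distr lborel borel T) E"
    by (subst emeasure_density_const) auto
  also have "emeasure (distr lborel borel T) E = emeasure lborel (cball (0 :: complex^'n) (sqrt x))"
    by (simp add: emeasure_distr preE)
  also have "\<dots> = ennreal (unit_ball_vol (real (2 * CARD('n))) * sqrt x ^ (2 * CARD('n)))"
    using x by (subst emeasure_cball) (auto simp: mult.commute)
  also have "sqrt x ^ (2 * CARD('n)) = x ^ CARD('n)" using x by (simp add: power_mult)
  also have "(\<Prod>j\<in>Basis. \<bar>c j\<bar>) = 1 / (\<Prod>i\<in>UNIV. lam i)"
    using pos by (simp add: prod_Basis_vec c_axis Basis_complex_def power2_eq_square[symmetric] power_divide
        prod_dividef less_imp_le)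
  finally show ?thesis
    using x pos unfolding E_def[symmetric] unit_ball_vol_even
    by (simp add: ennreal_mult'[symmetric] prod_pos less_imp_le field_simps)
qed

text \<open>With \<open>m\<close> the smallest coefficient, \<open>Q z \<le> x\<close> forces the
  squared norm of \<open>z\<close> below \<open>x / m\<close>. On that set the Gaussian density lies
  between \<open>exp (- x / m)\<close> and 1 times its value at the origin, and the ellipsoid volume
  does the rest.\<close>

proposition (in prob_space) gaussian_quadratic_form_small_ball:
  fixes h :: "'a \<Rightarrow> complex^'n" and lam :: "'n \<Rightarrow> real" and Q :: "complex^'n \<Rightarrow> real"
  assumes dens: "\<And>k. distributed M lborel (\<lambda>\<omega>. h \<omega> $ k) cn_density"
    and indep: "indep_vars (\<lambda>_. borel) (\<lambda>k \<omega>. h \<omega> $ k) UNIV"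
    and pos: "\<And>i. lam i > 0" and g: "orthogonal_transformation g"
    and Q: "\<And>z. Q z = (\<Sum>i\<in>UNIV. lam i * (cmod (g z $ i))\<^sup>2)"
  shows "((\<lambda>x. prob {\<omega> \<in> space M. Q (h \<omega>) \<le> x} / x ^ CARD('n)) \<longlongrightarrow> 1 / (fact CARD('n) * (\<Prod>i\<in>UNIV. lam i))) (at_right 0)"
proof -
  define c where "c = 1 / (fact CARD('n) * (\<Prod>i\<in>UNIV. lam i))"
  define m where "m = Min (range lam)"
  have m: "m > 0" "\<And>i. m \<le> lam i" using pos by (auto simp: m_def)
  have [measurable]: "g \<in> borel_measurable borel"
    using orthogonal_transformation_linear[OF g]
    by (intro borel_measurable_continuous_onI linear_continuous_on) (simp add: linear_conv_bounded_linear)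
  have [measurable]: "Q \<in> borel_measurable borel" unfolding Q[abs_def] by measurable
  have "(\<lambda>\<omega>. \<chi> k. h \<omega> $ k) \<in> borel_measurable M"
    by (rule borel_measurable_vec_lambda) (use distributed_measurable[OF dens] in simp)
  then have [measurable]: "h \<in> borel_measurable M" by simp
  have bd: "exp (- x / m) * c \<le> prob {\<omega> \<in> space M. Q (h \<omega>) \<le> x} / x ^ CARD('n) \<and>
      prob {\<omega> \<in> space M. Q (h \<omega>) \<le> x} / x ^ CARD('n) \<le> c" if x: "x > 0" for x
  proof -
    define S where "S = {z. Q z \<le> x}"
    have [measurable]: "S \<in> sets borel" unfolding S_def by measurable
    have "S = g -` {z. (\<Sum>i\<in>UNIV. lam i * (cmod (z $ i))\<^sup>2) \<le> x}" by (auto simp: S_def Q)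
    then have "emeasure lborel S = emeasure lborel {z :: complex^'n. (\<Sum>i\<in>UNIV. lam i * (cmod (z $ i))\<^sup>2) \<le> x}"
      using emeasure_lborel_orthogonal_preimage[OF g, of "{z. (\<Sum>i\<in>UNIV. lam i * (cmod (z $ i))\<^sup>2) \<le> x}"]
      by simp
    also have "\<dots> = ennreal (pi ^ CARD('n) * x ^ CARD('n) * c)"
      using emeasure_lborel_complex_ellipsoid[of lam x, OF pos x] by (simp add: c_def)
    finally have vol: "emeasure lborel S = ennreal (pi ^ CARD('n) * x ^ CARD('n) * c)" .
    have c0: "c > 0" using pos by (simp add: c_def prod_pos)
    have "emeasure M {\<omega> \<in> space M. Q (h \<omega>) \<le> x} = emeasure (distr M borel h) S"
      by (subst emeasure_distr) (auto simp: S_def intro!: arg_cong[where f = "emeasure M"])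
    also have "\<dots> = (\<integral>\<^sup>+z. ennreal (exp (- (norm z)\<^sup>2) / pi ^ CARD('n)) * indicator S z \<partial>lborel)"
      unfolding distr_complex_gaussian_vector[OF dens indep] by (subst emeasure_density) auto
    finally have P: "ennreal (prob {\<omega> \<in> space M. Q (h \<omega>) \<le> x}) =
      (\<integral>\<^sup>+z. ennreal (exp (- (norm z)\<^sup>2) / pi ^ CARD('n)) * indicator S z \<partial>lborel)"
      by (simp add: emeasure_eq_measure)
    have "(\<integral>\<^sup>+z. ennreal (exp (- (norm z)\<^sup>2) / pi ^ CARD('n)) * indicator S z \<partial>lborel) \<le>
        (\<integral>\<^sup>+z. ennreal (1 / pi ^ CARD('n)) * indicator S z \<partial>lborel)"
      by (intro nn_integral_mono mult_right_mono ennreal_leI divide_right_mono) auto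
    also have "\<dots> = ennreal (1 / pi ^ CARD('n)) * emeasure lborel S"
      by (rule nn_integral_cmult_indicator) simp
    also have "\<dots> = ennreal (x ^ CARD('n) * c)"
      unfolding vol using x c0 by (simp add: ennreal_mult'[symmetric])
    finally have up: "prob {\<omega> \<in> space M. Q (h \<omega>) \<le> x} \<le> x ^ CARD('n) * c"
      unfolding P[symmetric] using x c0 by simp
    have nz: "(norm z)\<^sup>2 \<le> x / m" if "z \<in> S" for z
    proof -
      have "(norm z)\<^sup>2 = (norm (g z))\<^sup>2" using g by (simp add: orthogonal_transformation_norm)
      then have "m * (norm z)\<^sup>2 = (\<Sum>i\<in>UNIV. m * (cmod (g z $ i))\<^sup>2)"
        by (simp add: norm_vec_complex_sq sum_distrib_left)
      also have "\<dots> \<le> Q z" unfolding Q using m by (intro sum_mono mult_right_mono) auto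
      finally show ?thesis using that m by (simp add: S_def field_simps)
    qed
    have "ennreal (exp (- x / m) * (x ^ CARD('n) * c)) = ennreal (exp (- x / m) / pi ^ CARD('n)) * emeasure lborel S"
      unfolding vol using x c0 by (simp add: ennreal_mult'[symmetric])
    also have "\<dots> = (\<integral>\<^sup>+z. ennreal (exp (- x / m) / pi ^ CARD('n)) * indicator S z \<partial>lborel)"
      by (rule nn_integral_cmult_indicator[symmetric]) simp
    also have "\<dots> \<le> (\<integral>\<^sup>+z. ennreal (exp (- (norm z)\<^sup>2) / pi ^ CARD('n)) * indicator S z \<partial>lborel)"
      by (intro nn_integral_mono) (auto simp: indicator_def intro!: ennreal_leI divide_right_mono dest: nz)
    finally have lo: "exp (- x / m) * (x ^ CARD('n) * c) \<le> prob {\<omega> \<in> space M. Q (h \<omega>) \<le> x}"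
      unfolding P[symmetric] by simp
    show ?thesis using up lo x by (simp add: field_simps)
  qed
  have ev: "\<forall>\<^sub>F x in at_right (0::real). x > 0" by (rule eventually_at_right_less)
  have "((\<lambda>x. exp (- x / m) * c) \<longlongrightarrow> c) (at_right 0)"
    using m by (auto intro!: tendsto_eq_intros)
  then have "((\<lambda>x. prob {\<omega> \<in> space M. Q (h \<omega>) \<le> x} / x ^ CARD('n)) \<longlongrightarrow> c) (at_right 0)"
    by (rule tendsto_sandwich[rotated 2, OF _ tendsto_const]) (use ev in \<open>eventually_elim, use bd in blast\<close>)+
  then show ?thesis by (simp add: c_def)
qed

section \<open>Products of independent variables with power-law small balls\<close>

text \<open>For a fixed tolerance \<delta> the lower and upper bounds may have different limits;
  these meet at \<open>c\<close> only as \<delta> tends to 0. Each neighbourhood of \<open>c\<close>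
  is reached by one suitable \<delta>.\<close>

lemma tendsto_sandwich_family:
  fixes f :: "'a \<Rightarrow> real" and L U :: "real \<Rightarrow> real"
  assumes bounds: "\<And>\<delta>. 0 < \<delta> \<Longrightarrow> \<delta> < 1 \<Longrightarrow> \<exists>l u. (l \<longlongrightarrow> L \<delta>) F \<and> (u \<longlongrightarrow> U \<delta>) F \<and>
      (\<forall>\<^sub>F x in F. l x \<le> f x \<and> f x \<le> u x)"
    and L: "(L \<longlongrightarrow> c) (at_right 0)" and U: "(U \<longlongrightarrow> c) (at_right 0)"
  shows "(f \<longlongrightarrow> c) F"
proof (rule order_tendstoI)
  have ev: "\<forall>\<^sub>F \<delta> in at_right (0::real). 0 < \<delta> \<and> \<delta> < 1"
    using eventually_at_right_real[of 0 1] by (auto elim: eventually_mono)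
  fix a assume "a < c"
  from order_tendstoD(1)[OF L this] ev have "\<forall>\<^sub>F \<delta> in at_right 0. a < L \<delta> \<and> 0 < \<delta> \<and> \<delta> < 1"
    by (rule eventually_conj)
  then obtain \<delta> where d: "a < L \<delta>" "0 < \<delta>" "\<delta> < 1"
    using eventually_happens'[OF trivial_limit_at_right_real] by blast
  obtain l where l: "(l \<longlongrightarrow> L \<delta>) F" "\<forall>\<^sub>F x in F. l x \<le> f x"
    using bounds[OF d(2,3)] by (metis (mono_tags, lifting) eventually_mono)
  show "\<forall>\<^sub>F x in F. a < f x"
    using order_tendstoD(1)[OF l(1) d(1)] l(2) by eventually_elim simp
next
  have ev: "\<forall>\<^sub>F \<delta> in at_right (0::real). 0 < \<delta> \<and> \<delta> < 1"
    using eventually_at_right_real[of 0 1] by (auto elim: eventually_mono)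
  fix a assume "c < a"
  from order_tendstoD(2)[OF U this] ev have "\<forall>\<^sub>F \<delta> in at_right 0. U \<delta> < a \<and> 0 < \<delta> \<and> \<delta> < 1"
    by (rule eventually_conj)
  then obtain \<delta> where d: "U \<delta> < a" "0 < \<delta>" "\<delta> < 1"
    using eventually_happens'[OF trivial_limit_at_right_real] by blast
  obtain u where u: "(u \<longlongrightarrow> U \<delta>) F" "\<forall>\<^sub>F x in F. f x \<le> u x"
    using bounds[OF d(2,3)] by (metis (mono_tags, lifting) eventually_mono)
  show "\<forall>\<^sub>F x in F. f x < a"
    using order_tendstoD(2)[OF u(1) d(1)] u(2) by eventually_elim simp
qed

section \<open>Truncated inverse moments by layer-cake integration\<close>

lemma nn_integral_power_tail:
  fixes x :: real
  assumes "x > 0" "N > 0"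
  shows "(\<integral>\<^sup>+u. ennreal (real N / u ^ Suc N) * indicator {x..} u \<partial>lborel) = ennreal (1 / x ^ N)"
proof -
  have "(\<integral>\<^sup>+u. ennreal (real N / u ^ Suc N) * indicator {x..} u \<partial>lborel)
      = ennreal (0 - (\<lambda>u. - (1 / u ^ N)) x)"
  proof (rule nn_integral_FTC_atLeast)
    show "(\<lambda>u. real N / u ^ Suc N) \<in> borel_measurable borel" by measurable
    show "((\<lambda>u. - (1 / u ^ N)) has_real_derivative real N / u ^ Suc N) (at u)" if "x \<le> u" for u
    proof -
      have "u > 0" using that assms by simp
      then show ?thesis
        using assms power_minus_mult[of N u]
        by (auto intro!: derivative_eq_intros simp: power2_eq_square divide_simps mult_ac)
    qed
    show "0 \<le> real N / u ^ Suc N" if "x \<le> u" for u using that assms by simp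
    show "((\<lambda>u::real. - (1 / u ^ N)) \<longlongrightarrow> 0) at_top"
    proof -
      have "((\<lambda>u::real. inverse (u ^ N)) \<longlongrightarrow> 0) at_top"
        using assms by (intro tendsto_inverse_0_at_top filterlim_pow_at_top filterlim_ident) auto
      from tendsto_minus[OF this] show ?thesis by (simp add: inverse_eq_divide)
    qed
  qed
  then show ?thesis by simp
qed

lemma nn_integral_inverse_Icc:
  fixes a s C :: real
  assumes "0 < a" "a \<le> s" "C \<ge> 0"
  shows "(\<integral>\<^sup>+u. ennreal (C / u) * indicator {a..s} u \<partial>lborel) = ennreal (C * ln (s / a))"
proof -
  have "(\<integral>\<^sup>+u. ennreal (C / u) * indicator {a..s} u \<partial>lborel) = ennreal (C * ln s - C * ln a)"
    using assms by (intro nn_integral_FTC_Icc[where F = "\<lambda>u. C * ln u"])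
      (auto intro!: derivative_eq_intros simp: field_simps)
  then show ?thesis using assms by (simp add: ln_div algebra_simps)
qed

text \<open>The expectation of \<open>1 / X ^ N\<close> on the event \<open>X > a\<close>, for
  \<open>X\<close> with law \<nu>. If \<nu> has small balls of order \<open>x ^ N\<close>, it
  diverges logarithmically as \<open>a\<close> tends to 0; this is the source of the logarithm in
  the outage probability.\<close>

definition truncated_inverse_moment :: "real measure \<Rightarrow> nat \<Rightarrow> real \<Rightarrow> ennreal" where
  "truncated_inverse_moment \<nu> N a = (\<integral>\<^sup>+x. ennreal (1 / x ^ N) * indicator {a<..} x \<partial>\<nu>)"

text \<open>Write \<open>1 / x ^ N\<close> as a tail integral starting at \<open>x\<close> and
  exchange the integrals: for fixed \<open>u\<close>, exactly the points of \<open>{a<..u}\<close>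
  contribute.\<close>

lemma truncated_inverse_moment_layer_cake:
  fixes \<nu> :: "real measure"
  assumes "prob_space \<nu>" and [measurable_cong]: "sets \<nu> = sets borel" and "N > 0" "a > 0"
  shows "truncated_inverse_moment \<nu> N a =
    (\<integral>\<^sup>+u. ennreal (real N / u ^ Suc N) * indicator {a<..} u * emeasure \<nu> {a<..u} \<partial>lborel)"
proof -
  interpret prob_space \<nu> by fact
  interpret pair_sigma_finite \<nu> lborel ..
  define f where "f = (\<lambda>x u. ennreal (real N / u ^ Suc N) * indicator {x..} u * indicator {a<..} x)"
  have [measurable]: "(\<lambda>(x, u). f x u) \<in> borel_measurable (\<nu> \<Otimes>\<^sub>M lborel)"
  proof -
    have "(\<lambda>(x, u). f x u) = (\<lambda>(x, u). ennreal (real N / u ^ Suc N) * (if x \<le> u then 1 else 0) * indicator {a<..} x)"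
      unfolding f_def by (auto simp: fun_eq_iff)
    then show ?thesis by simp
  qed
  have "truncated_inverse_moment \<nu> N a = (\<integral>\<^sup>+x. (\<integral>\<^sup>+u. f x u \<partial>lborel) \<partial>\<nu>)"
    unfolding truncated_inverse_moment_def
  proof (rule nn_integral_cong)
    fix x :: real
    show "ennreal (1 / x ^ N) * indicator {a<..} x = (\<integral>\<^sup>+u. f x u \<partial>lborel)"
    proof (cases "a < x")
      case True
      then have "x > 0" using assms by simp
      then show ?thesis unfolding f_def using True nn_integral_power_tail[OF _ \<open>N > 0\<close>, of x] by simp
    qed (simp add: f_def)
  qed
  also have "\<dots> = (\<integral>\<^sup>+u. (\<integral>\<^sup>+x. f x u \<partial>\<nu>) \<partial>lborel)"
    by (rule Fubini'[symmetric]) measurable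
  also have "\<dots> = (\<integral>\<^sup>+u. ennreal (real N / u ^ Suc N) * indicator {a<..} u * emeasure \<nu> {a<..u} \<partial>lborel)"
  proof (rule nn_integral_cong)
    fix u :: real
    have "(\<integral>\<^sup>+x. f x u \<partial>\<nu>) = (\<integral>\<^sup>+x. ennreal (real N / u ^ Suc N) * indicator {a<..u} x \<partial>\<nu>)"
      by (rule nn_integral_cong) (auto simp: f_def indicator_def)
    also have "\<dots> = ennreal (real N / u ^ Suc N) * emeasure \<nu> {a<..u}"
      by (subst nn_integral_cmult_indicator) (auto simp: assms)
    also have "\<dots> = ennreal (real N / u ^ Suc N) * indicator {a<..} u * emeasure \<nu> {a<..u}"
      by (auto simp: indicator_def)
    finally show "(\<integral>\<^sup>+x. f x u \<partial>\<nu>) = ennreal (real N / u ^ Suc N) * indicator {a<..} u * emeasure \<nu> {a<..u}" .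
  qed
  finally show ?thesis .
qed

text \<open>Below \<open>s\<close> the power law turns the layer-cake integrand into a multiple of
  \<open>1 / u\<close>, which integrates to the logarithm. Above \<open>s\<close> the mass is
  bounded by 1 and the tail integral is \<open>1 / s ^ N\<close>.\<close>

lemma truncated_inverse_moment_upper:
  fixes \<nu> :: "real measure"
  assumes \<nu>: "prob_space \<nu>" "sets \<nu> = sets borel" and N: "N > 0" and a: "0 < a" "a < s" and C: "C \<ge> 0"
    and F: "\<And>u. 0 < u \<Longrightarrow> u < s \<Longrightarrow> measure \<nu> {..u} \<le> C * u ^ N"
  shows "truncated_inverse_moment \<nu> N a \<le> ennreal (real N * C * ln (s / a) + 1 / s ^ N)"
proof -
  interpret prob_space \<nu> by fact
  have "truncated_inverse_moment \<nu> N a \<le> (\<integral>\<^sup>+u. (ennreal (real N * C / u) * indicator {a..s} u +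
      ennreal (real N / u ^ Suc N) * indicator {s..} u) \<partial>lborel)"
    unfolding truncated_inverse_moment_layer_cake[OF \<nu> N a(1)]
  proof (rule nn_integral_mono)
    fix u :: real
    consider "u \<le> a" | "a < u" "u < s" | "s \<le> u" by linarith
    then show "ennreal (real N / u ^ Suc N) * indicator {a<..} u * emeasure \<nu> {a<..u} \<le>
      ennreal (real N * C / u) * indicator {a..s} u + ennreal (real N / u ^ Suc N) * indicator {s..} u"
    proof cases
      case 2
      have "emeasure \<nu> {a<..u} \<le> emeasure \<nu> {..u}" by (intro emeasure_mono) (auto simp: \<nu>)
      also have "\<dots> \<le> ennreal (C * u ^ N)" using F[of u] 2 a by (simp add: emeasure_eq_measure ennreal_leI)
      finally have "ennreal (real N / u ^ Suc N) * emeasure \<nu> {a<..u} \<le> ennreal (real N / u ^ Suc N) * ennreal (C * u ^ N)"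
        by (rule mult_left_mono) simp
      also have "\<dots> = ennreal (real N * C / u)" using 2 a C by (simp add: ennreal_mult'[symmetric] field_simps)
      finally show ?thesis using 2 by simp
    next
      case 3
      have "ennreal (real N / u ^ Suc N) * emeasure \<nu> {a<..u} \<le> ennreal (real N / u ^ Suc N) * 1"
        by (intro mult_left_mono) (auto simp: emeasure_eq_measure)
      then show ?thesis using 3 a by (simp add: add_increasing)
    qed simp
  qed
  also have "\<dots> = ennreal (real N * C * ln (s / a)) + ennreal (1 / s ^ N)"
    using nn_integral_inverse_Icc[of a s "real N * C"] nn_integral_power_tail[of s N] a C N
    by (subst nn_integral_add) simp_all
  also have "\<dots> = ennreal (real N * C * ln (s / a) + 1 / s ^ N)"
    using a C by (intro ennreal_plus[symmetric]) auto
  finally show ?thesis .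
qed

text \<open>The mass of \<open>{a<..u}\<close> is that of \<open>{..u}\<close> minus that of
  \<open>{..a}\<close>. The subtracted part costs at most \<open>C * a ^ N\<close> times
  \<open>1 / a ^ N\<close>, that is \<open>C\<close>; it is added on the right because subtraction
  in \<open>ennreal\<close> truncates.\<close>

lemma truncated_inverse_moment_lower:
  fixes \<nu> :: "real measure"
  assumes \<nu>: "prob_space \<nu>" "sets \<nu> = sets borel" and N: "N > 0" and a: "0 < a" "a < s"
    and C: "C \<ge> 0" "C' \<ge> 0"
    and F: "measure \<nu> {..a} \<le> C * a ^ N"
    and F': "\<And>u. 0 < u \<Longrightarrow> u < s \<Longrightarrow> C' * u ^ N \<le> measure \<nu> {..u}"
  shows "ennreal (real N * C' * ln (s / a)) \<le> truncated_inverse_moment \<nu> N a + ennreal C"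
proof -
  interpret prob_space \<nu> by fact
  have "ennreal (real N * C' * ln (s / a)) = (\<integral>\<^sup>+u. ennreal (real N * C' / u) * indicator {a..s} u \<partial>lborel)"
    using nn_integral_inverse_Icc[of a s "real N * C'"] a C by simp
  also have "\<dots> \<le> (\<integral>\<^sup>+u. (ennreal (real N / u ^ Suc N) * indicator {a<..} u * emeasure \<nu> {a<..u} +
      ennreal (C * a ^ N) * (ennreal (real N / u ^ Suc N) * indicator {a..} u)) \<partial>lborel)"
  proof (rule nn_integral_mono_AE)
    \<comment> \<open>The comparison is carried out for \<open>a < u\<close> and
      \<open>u < s\<close>; the two endpoints form a null set.\<close>
    have "AE u in lborel. u \<noteq> a \<and> u \<noteq> s" using AE_lborel_singleton[of a] AE_lborel_singleton[of s] by eventually_elim simp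
    then show "AE u in lborel. ennreal (real N * C' / u) * indicator {a..s} u \<le>
      ennreal (real N / u ^ Suc N) * indicator {a<..} u * emeasure \<nu> {a<..u} +
      ennreal (C * a ^ N) * (ennreal (real N / u ^ Suc N) * indicator {a..} u)"
    proof eventually_elim
      case (elim u)
      show ?case
      proof (cases "a < u \<and> u < s")
        case True
        have "measure \<nu> {..u} = measure \<nu> {..a} + measure \<nu> {a<..u}"
        proof -
          have "{..u} = {..a} \<union> {a<..u}" using True by auto
          then show ?thesis by (metis finite_measure_Union \<nu>(2) atMost_borel greaterThanAtMost_borel ivl_disj_int_one(3))
        qed
        with F F'[of u] True a have "C' * u ^ N \<le> measure \<nu> {a<..u} + C * a ^ N" by simp
        then have "ennreal (real N / u ^ Suc N * (C' * u ^ N)) \<le> ennreal (real N / u ^ Suc N * (measure \<nu> {a<..u} + C * a ^ N))"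
          using True a by (intro ennreal_leI mult_left_mono) auto
        also have "real N / u ^ Suc N * (C' * u ^ N) = real N * C' / u" using True a by (simp add: field_simps)
        also have "ennreal (real N / u ^ Suc N * (measure \<nu> {a<..u} + C * a ^ N)) =
          ennreal (real N / u ^ Suc N) * emeasure \<nu> {a<..u} + ennreal (C * a ^ N) * ennreal (real N / u ^ Suc N)"
          using True a C by (simp add: emeasure_eq_measure ennreal_mult'[symmetric] ennreal_plus[symmetric] algebra_simps del: ennreal_plus)
        finally show ?thesis using True by simp
      next
        case False
        with elim show ?thesis by (auto simp: indicator_def)
      qed
    qed
  qed
  also have "\<dots> = truncated_inverse_moment \<nu> N a + ennreal (C * a ^ N) * ennreal (1 / a ^ N)"
  proof -
    have [measurable]: "(\<lambda>u. measure \<nu> {a<..u}) \<in> borel_measurable borel"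
      by (intro borel_measurable_mono monoI finite_measure_mono) (auto simp: \<nu>)
    have [measurable]: "(\<lambda>u. emeasure \<nu> {a<..u}) \<in> borel_measurable borel"
      unfolding emeasure_eq_measure by measurable
    show ?thesis
      unfolding truncated_inverse_moment_layer_cake[OF \<nu> N a(1)]
      using nn_integral_power_tail[OF a(1) N]
      by (subst nn_integral_add) (auto simp: nn_integral_cmult)
  qed
  also have "ennreal (C * a ^ N) * ennreal (1 / a ^ N) = ennreal C"
    using a C by (simp add: ennreal_mult'[symmetric])
  finally show ?thesis .
qed

section \<open>The product of two independent variables near 0\<close>

lemma eventually_power_law_bounds:
  fixes F :: "real \<Rightarrow> real"
  assumes lim: "((\<lambda>x. F x / x ^ N) \<longlongrightarrow> c) (at_right 0)" and c: "c > 0" and d: "0 < \<delta>"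
  obtains s where "s > 0" "\<And>u. 0 < u \<Longrightarrow> u < s \<Longrightarrow> (1 - \<delta>) * c * u ^ N \<le> F u"
    "\<And>u. 0 < u \<Longrightarrow> u < s \<Longrightarrow> F u \<le> (1 + \<delta>) * c * u ^ N"
proof -
  have "\<forall>\<^sub>F x in at_right 0. (1 - \<delta>) * c < F x / x ^ N \<and> F x / x ^ N < (1 + \<delta>) * c"
    using order_tendstoD(1)[OF lim, of "(1 - \<delta>) * c"] order_tendstoD(2)[OF lim, of "(1 + \<delta>) * c"] c d
    by (intro eventually_conj) (auto simp: algebra_simps)
  then obtain s where "s > 0" and s: "\<And>u. 0 < u \<Longrightarrow> u < s \<Longrightarrow> (1 - \<delta>) * c < F u / u ^ N \<and> F u / u ^ N < (1 + \<delta>) * c"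
    unfolding eventually_at_right_field by auto
  then show thesis
    by (intro that[of s]) (use s in \<open>force simp: field_simps\<close>)+
qed

text \<open>Condition on the first factor. For \<open>x > t / r\<close> the section is
  \<open>{..t / x}\<close> with \<open>t / x < r\<close>, where the power law of \<kappa> applies
  and produces \<open>1 / x ^ N\<close>. For the remaining \<open>x\<close> the section is bounded
  by 1 from above and discarded from below.\<close>

lemma pair_measure_product_le_bounds:
  fixes \<nu> \<kappa> :: "real measure"
  assumes \<nu>: "prob_space \<nu>" "sets \<nu> = sets borel" and \<kappa>: "prob_space \<kappa>" "sets \<kappa> = sets borel"
    and r: "r > 0" and t: "t > 0" and B: "B \<ge> 0" "B' \<ge> 0"
    and F: "\<And>u. 0 < u \<Longrightarrow> u < r \<Longrightarrow> measure \<kappa> {..u} \<le> B * u ^ N"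
    and F': "\<And>u. 0 < u \<Longrightarrow> u < r \<Longrightarrow> B' * u ^ N \<le> measure \<kappa> {..u}"
  shows "emeasure (\<nu> \<Otimes>\<^sub>M \<kappa>) {(x, y). x * y \<le> t} \<le> emeasure \<nu> {..t / r} + ennreal (B * t ^ N) * truncated_inverse_moment \<nu> N (t / r)"
    and "ennreal (B' * t ^ N) * truncated_inverse_moment \<nu> N (t / r) \<le> emeasure (\<nu> \<Otimes>\<^sub>M \<kappa>) {(x, y). x * y \<le> t}"
proof -
  interpret \<nu>: prob_space \<nu> by fact
  interpret \<kappa>: prob_space \<kappa> by fact
  note [measurable_cong] = \<nu>(2) \<kappa>(2)
  have sp: "space \<nu> = UNIV" "space \<kappa> = UNIV" using sets_eq_imp_space_eq[OF \<nu>(2)] sets_eq_imp_space_eq[OF \<kappa>(2)] by auto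
  have "{z \<in> space (\<nu> \<Otimes>\<^sub>M \<kappa>). fst z * snd z \<le> t} \<in> sets (\<nu> \<Otimes>\<^sub>M \<kappa>)" by measurable
  then have meas: "{(x, y). x * y \<le> t} \<in> sets (\<nu> \<Otimes>\<^sub>M \<kappa>)" by (simp add: space_pair_measure sp case_prod_unfold)
  have eq: "emeasure (\<nu> \<Otimes>\<^sub>M \<kappa>) {(x, y). x * y \<le> t} = (\<integral>\<^sup>+x. emeasure \<kappa> {y. x * y \<le> t} \<partial>\<nu>)"
    by (subst \<kappa>.emeasure_pair_measure_alt[OF meas]) (simp add: vimage_def)
  have sec: "{y. x * y \<le> t} = {..t / x}" "0 < t / x" "t / x < r" if "t / r < x" for x
  proof -
    have "x > 0" using that r t by (meson divide_pos_pos less_trans)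
    then show "{y. x * y \<le> t} = {..t / x}" "0 < t / x" "t / x < r" using that t r by (auto simp: field_simps)
  qed
  have "(\<integral>\<^sup>+x. emeasure \<kappa> {y. x * y \<le> t} \<partial>\<nu>) \<le>
      (\<integral>\<^sup>+x. indicator {..t / r} x + ennreal (B * t ^ N) * (ennreal (1 / x ^ N) * indicator {t / r<..} x) \<partial>\<nu>)"
  proof (rule nn_integral_mono)
    fix x :: real
    show "emeasure \<kappa> {y. x * y \<le> t} \<le> indicator {..t / r} x + ennreal (B * t ^ N) * (ennreal (1 / x ^ N) * indicator {t / r<..} x)"
    proof (cases "t / r < x")
      case True
      then have "emeasure \<kappa> {y. x * y \<le> t} \<le> ennreal (B * (t / x) ^ N)"
        using F[of "t / x"] sec[OF True] by (simp add: \<kappa>.emeasure_eq_measure ennreal_leI)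
      also have "\<dots> = ennreal (B * t ^ N) * ennreal (1 / x ^ N)"
        using B t by (simp add: ennreal_mult'[symmetric] power_divide)
      finally show ?thesis using True by simp
    qed (auto simp: \<kappa>.emeasure_eq_measure)
  qed
  also have "\<dots> = emeasure \<nu> {..t / r} + ennreal (B * t ^ N) * truncated_inverse_moment \<nu> N (t / r)"
    unfolding truncated_inverse_moment_def by (subst nn_integral_add) (auto simp: nn_integral_cmult)
  finally show "emeasure (\<nu> \<Otimes>\<^sub>M \<kappa>) {(x, y). x * y \<le> t} \<le> emeasure \<nu> {..t / r} + ennreal (B * t ^ N) * truncated_inverse_moment \<nu> N (t / r)"
    unfolding eq .
  have "ennreal (B' * t ^ N) * truncated_inverse_moment \<nu> N (t / r) =
      (\<integral>\<^sup>+x. ennreal (B' * t ^ N) * (ennreal (1 / x ^ N) * indicator {t / r<..} x) \<partial>\<nu>)"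
    unfolding truncated_inverse_moment_def by (rule nn_integral_cmult[symmetric]) simp
  also have "\<dots> \<le> (\<integral>\<^sup>+x. emeasure \<kappa> {y. x * y \<le> t} \<partial>\<nu>)"
  proof (rule nn_integral_mono)
    fix x :: real
    show "ennreal (B' * t ^ N) * (ennreal (1 / x ^ N) * indicator {t / r<..} x) \<le> emeasure \<kappa> {y. x * y \<le> t}"
    proof (cases "t / r < x")
      case True
      have "ennreal (B' * t ^ N) * ennreal (1 / x ^ N) = ennreal (B' * (t / x) ^ N)"
        using B t by (simp add: ennreal_mult'[symmetric] power_divide)
      also have "\<dots> \<le> emeasure \<kappa> {y. x * y \<le> t}"
        using F'[of "t / x"] sec[OF True] by (simp add: \<kappa>.emeasure_eq_measure ennreal_leI)
      finally show ?thesis using True by simp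
    qed simp
  qed
  finally show "ennreal (B' * t ^ N) * truncated_inverse_moment \<nu> N (t / r) \<le> emeasure (\<nu> \<Otimes>\<^sub>M \<kappa>) {(x, y). x * y \<le> t}"
    unfolding eq .
qed

text \<open>The moment truncated at \<open>t / r\<close> grows like a multiple of
  \<open>ln (s * r / t)\<close>, which is equivalent to \<open>ln (1 / t)\<close>, so the cutoffs
  \<open>s\<close> and \<open>r\<close> and all bounded terms vanish in the limit. What remains are
  factors \<open>1 - \<delta>\<close> and \<open>1 + \<delta>\<close>, each squared.\<close>

proposition product_small_ball_asymptotics:
  fixes \<nu> \<kappa> :: "real measure"
  assumes \<nu>: "prob_space \<nu>" "sets \<nu> = sets borel" and \<kappa>: "prob_space \<kappa>" "sets \<kappa> = sets borel"
    and N: "N > 0" and c: "c1 > 0" "c2 > 0"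
    and l1: "((\<lambda>x. measure \<nu> {..x} / x ^ N) \<longlongrightarrow> c1) (at_right 0)"
    and l2: "((\<lambda>x. measure \<kappa> {..x} / x ^ N) \<longlongrightarrow> c2) (at_right 0)"
  shows "((\<lambda>t. measure (\<nu> \<Otimes>\<^sub>M \<kappa>) {(x, y). x * y \<le> t} / (t ^ N * ln (1 / t))) \<longlongrightarrow> real N * c1 * c2) (at_right 0)"
proof (rule tendsto_sandwich_family)
  interpret \<nu>: prob_space \<nu> by fact
  interpret \<kappa>: prob_space \<kappa> by fact
  interpret pair_prob_space \<nu> \<kappa> ..
  fix \<delta> :: real assume d: "0 < \<delta>" "\<delta> < 1"
  obtain s where s: "s > 0" "\<And>u. 0 < u \<Longrightarrow> u < s \<Longrightarrow> (1 - \<delta>) * c1 * u ^ N \<le> measure \<nu> {..u}"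
    "\<And>u. 0 < u \<Longrightarrow> u < s \<Longrightarrow> measure \<nu> {..u} \<le> (1 + \<delta>) * c1 * u ^ N"
    using eventually_power_law_bounds[OF l1 c(1) d(1)] by blast
  obtain r where r: "r > 0" "\<And>u. 0 < u \<Longrightarrow> u < r \<Longrightarrow> (1 - \<delta>) * c2 * u ^ N \<le> measure \<kappa> {..u}"
    "\<And>u. 0 < u \<Longrightarrow> u < r \<Longrightarrow> measure \<kappa> {..u} \<le> (1 + \<delta>) * c2 * u ^ N"
    using eventually_power_law_bounds[OF l2 c(2) d(1)] by blast
  define C C' B B' where CB: "C = (1 + \<delta>) * c1" "C' = (1 - \<delta>) * c1" "B = (1 + \<delta>) * c2" "B' = (1 - \<delta>) * c2"
  have pos: "C > 0" "C' > 0" "B > 0" "B' > 0" using c d by (auto simp: CB)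
  \<comment> \<open>\<open>l\<close> and \<open>u\<close> are the bounds on the probability divided
    by \<open>t ^ N * ln (1 / t)\<close>; the quotient \<open>s / (t / r)\<close> of the moment
    bounds appears as \<open>s * r / t\<close>.\<close>
  define l where "l = (\<lambda>t. B' * (real N * C' * ln (s * r / t) - C) / ln (1 / t))"
  define u where "u = (\<lambda>t. (C / r ^ N + B * (real N * C * ln (s * r / t) + 1 / s ^ N)) / ln (1 / t))"
  have bd: "l t \<le> measure (\<nu> \<Otimes>\<^sub>M \<kappa>) {(x, y). x * y \<le> t} / (t ^ N * ln (1 / t)) \<and>
      measure (\<nu> \<Otimes>\<^sub>M \<kappa>) {(x, y). x * y \<le> t} / (t ^ N * ln (1 / t)) \<le> u t"
    if t: "0 < t" "t < s * r" "t < 1" for t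
  proof -
    have a: "0 < t / r" "t / r < s" using t r by (auto simp: field_simps)
    have L: "ln (1 / t) > 0" using t by simp
    have Fa: "measure \<nu> {..t / r} \<le> C * (t / r) ^ N" using s(3)[OF a] by (simp add: CB)
    define H where "H = enn2real (truncated_inverse_moment \<nu> N (t / r))"
    have Hup: "truncated_inverse_moment \<nu> N (t / r) \<le> ennreal (real N * C * ln (s / (t / r)) + 1 / s ^ N)"
      by (rule truncated_inverse_moment_upper[OF \<nu> N a]) (use s pos in \<open>auto simp: CB\<close>)
    \<comment> \<open>The upper bound shows that the moment is finite, so the estimates can continue
      in the reals.\<close>
    have H: "truncated_inverse_moment \<nu> N (t / r) = ennreal H"
      unfolding H_def using Hup by (metis ennreal_enn2real ennreal_less_top order_le_less_trans)
    have H0: "H \<ge> 0" by (simp add: H_def)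
    have lnp: "ln (s * r / t) > 0" using t by (simp add: field_simps)
    have Hup': "H \<le> real N * C * ln (s * r / t) + 1 / s ^ N"
      using Hup lnp pos s(1) unfolding H by (subst (asm) ennreal_le_iff) auto
    have "ennreal (real N * C' * ln (s / (t / r))) \<le> truncated_inverse_moment \<nu> N (t / r) + ennreal C"
      by (rule truncated_inverse_moment_lower[OF \<nu> N a _ _ Fa]) (use s pos in \<open>auto simp: CB\<close>)
    then have Hlo: "real N * C' * ln (s * r / t) - C \<le> H"
      unfolding H using H0 pos by (simp add: ennreal_plus[symmetric] del: ennreal_plus)
    have P: "emeasure (\<nu> \<Otimes>\<^sub>M \<kappa>) {(x, y). x * y \<le> t} \<le> emeasure \<nu> {..t / r} + ennreal (B * t ^ N) * truncated_inverse_moment \<nu> N (t / r)"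
      "ennreal (B' * t ^ N) * truncated_inverse_moment \<nu> N (t / r) \<le> emeasure (\<nu> \<Otimes>\<^sub>M \<kappa>) {(x, y). x * y \<le> t}"
      by (rule pair_measure_product_le_bounds[OF \<nu> \<kappa> r(1) t(1), where B = B and B' = B']; use r pos in \<open>simp add: CB\<close>)+
    have up: "measure (\<nu> \<Otimes>\<^sub>M \<kappa>) {(x, y). x * y \<le> t} \<le> measure \<nu> {..t / r} + B * t ^ N * H"
      using P(1) H0 pos t unfolding H P.emeasure_eq_measure \<nu>.emeasure_eq_measure
      by (simp add: ennreal_mult'[symmetric] ennreal_plus[symmetric] del: ennreal_plus)
    have lo: "B' * t ^ N * H \<le> measure (\<nu> \<Otimes>\<^sub>M \<kappa>) {(x, y). x * y \<le> t}"
      using P(2) H0 pos t unfolding H P.emeasure_eq_measure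
      by (simp add: ennreal_mult'[symmetric])
    have "measure (\<nu> \<Otimes>\<^sub>M \<kappa>) {(x, y). x * y \<le> t} \<le> C * (t / r) ^ N + B * t ^ N * (real N * C * ln (s * r / t) + 1 / s ^ N)"
      using up Fa Hup' pos t by (smt (verit) mult_left_mono mult_nonneg_nonneg zero_le_power)
    also have "\<dots> = t ^ N * ln (1 / t) * u t"
      unfolding u_def using L r by (simp add: power_divide field_simps)
    finally have 1: "measure (\<nu> \<Otimes>\<^sub>M \<kappa>) {(x, y). x * y \<le> t} \<le> t ^ N * ln (1 / t) * u t" .
    have "t ^ N * ln (1 / t) * l t = B' * t ^ N * (real N * C' * ln (s * r / t) - C)"
      unfolding l_def using L by (simp add: field_simps)
    also have "\<dots> \<le> B' * t ^ N * H" using Hlo pos t by (intro mult_left_mono) auto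
    finally have 2: "t ^ N * ln (1 / t) * l t \<le> measure (\<nu> \<Otimes>\<^sub>M \<kappa>) {(x, y). x * y \<le> t}" using lo by simp
    have "t ^ N * ln (1 / t) > 0" using t L by simp
    then show ?thesis using 1 2 by (simp add: pos_le_divide_eq pos_divide_le_eq mult.commute)
  qed
  have inf: "filterlim (\<lambda>t::real. ln (1 / t)) at_top (at_right 0)" by real_asymp
  have ratio: "((\<lambda>t. ln (s * r / t) / ln (1 / t)) \<longlongrightarrow> 1) (at_right 0)"
    using s(1) r(1) by real_asymp
  have const: "((\<lambda>t. K / ln (1 / t)) \<longlongrightarrow> 0) (at_right 0)" for K :: real
    by (rule real_tendsto_divide_at_top[OF tendsto_const inf])
  have "(l \<longlongrightarrow> B' * (real N * C' * 1 - 0)) (at_right 0)"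
  proof -
    have "l = (\<lambda>t. B' * (real N * C' * (ln (s * r / t) / ln (1 / t)) - C / ln (1 / t)))"
      unfolding l_def by (simp add: fun_eq_iff diff_divide_distrib right_diff_distrib)
    then show ?thesis by (simp only:) (intro tendsto_intros ratio const)
  qed
  moreover have "(u \<longlongrightarrow> 0 + B * (real N * C * 1 + 0)) (at_right 0)"
  proof -
    have "u = (\<lambda>t. C / r ^ N / ln (1 / t) + B * (real N * C * (ln (s * r / t) / ln (1 / t)) + 1 / s ^ N / ln (1 / t)))"
      unfolding u_def by (simp add: fun_eq_iff add_divide_distrib distrib_left)
    then show ?thesis by (simp only:) (intro tendsto_intros ratio const)
  qed
  moreover have "\<forall>\<^sub>F t in at_right 0. 0 < t \<and> t < min (s * r) 1"
    using eventually_at_right_real[of 0 "min (s * r) 1"] s(1) r(1) by simp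
  then have "\<forall>\<^sub>F t in at_right 0. l t \<le> measure (\<nu> \<Otimes>\<^sub>M \<kappa>) {(x, y). x * y \<le> t} / (t ^ N * ln (1 / t)) \<and>
      measure (\<nu> \<Otimes>\<^sub>M \<kappa>) {(x, y). x * y \<le> t} / (t ^ N * ln (1 / t)) \<le> u t"
    by eventually_elim (rule bd; simp)
  ultimately show "\<exists>l u. (l \<longlongrightarrow> ((1 - \<delta>) * c2) * (real N * ((1 - \<delta>) * c1))) (at_right 0) \<and>
     (u \<longlongrightarrow> ((1 + \<delta>) * c2) * (real N * ((1 + \<delta>) * c1))) (at_right 0) \<and>
     (\<forall>\<^sub>F t in at_right 0. l t \<le> measure (\<nu> \<Otimes>\<^sub>M \<kappa>) {(x, y). x * y \<le> t} / (t ^ N * ln (1 / t)) \<and>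
      measure (\<nu> \<Otimes>\<^sub>M \<kappa>) {(x, y). x * y \<le> t} / (t ^ N * ln (1 / t)) \<le> u t)"
    unfolding CB by auto
qed (auto intro!: tendsto_eq_intros)

section \<open>Leading order of the asymptotic formula\<close>

text \<open>Lagrange interpolation of the constant polynomial 1, evaluated at 0.\<close>
lemma sum_inverse_div_prod_diff:
  fixes f :: "'i \<Rightarrow> 'a::field"
  assumes A: "finite A" "A \<noteq> {}" and inj: "inj_on f A" and nz: "\<And>i. i \<in> A \<Longrightarrow> f i \<noteq> 0"
  shows "(\<Sum>i\<in>A. inverse (f i) / (\<Prod>j\<in>A - {i}. f i - f j)) = (- 1) ^ (card A - 1) / (\<Prod>i\<in>A. f i)"
proof -
  have cardpos: "card A > 0" using A by (simp add: card_gt_0_iff)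
  define p where "p = (\<Sum>i\<in>A. smult (inverse (\<Prod>j\<in>A - {i}. f i - f j)) (\<Prod>j\<in>A - {i}. [:- f j, 1:]))"
  have ne: "(\<Prod>j\<in>A - {i}. f i - f j) \<noteq> 0" if "i \<in> A" for i
    using A inj that by (auto simp: inj_on_def)
  have "degree p \<le> card A - 1"
    unfolding p_def
  proof (intro degree_sum_le A order.trans[OF degree_smult_le])
    fix i assume "i \<in> A"
    have "degree (\<Prod>j\<in>A - {i}. [:- f j, 1:]) \<le> (\<Sum>j\<in>A - {i}. degree [:- f j, 1:])"
      by (rule degree_prod_sum_le[unfolded comp_def]) (use A in simp)
    then show "degree (\<Prod>j\<in>A - {i}. [:- f j, 1:]) \<le> card A - 1"
      using A \<open>i \<in> A\<close> by simp
  qed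
  \<comment> \<open>The degree is strictly below the number of nodes, so agreement with 1 on the
    nodes forces equality.\<close>
  then have deg: "degree p < card (f ` A)" using cardpos inj by (simp add: card_image)
  have "poly p x = poly 1 x" if "x \<in> f ` A" for x
  proof -
    from that obtain k where k: "k \<in> A" "x = f k" by blast
    have "poly p x = (\<Sum>i\<in>A. if i = k then 1 else 0)"
      unfolding p_def poly_sum
    proof (intro sum.cong refl)
      fix i assume i: "i \<in> A"
      show "poly (smult (inverse (\<Prod>j\<in>A - {i}. f i - f j)) (\<Prod>j\<in>A - {i}. [:- f j, 1:])) x = (if i = k then 1 else 0)"
      proof (cases "i = k")
        case True
        then show ?thesis using ne[OF i] k by (simp add: poly_prod)
      next
        case False
        then have "(\<Prod>j\<in>A - {i}. f k - f j) = 0" using A k by auto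
        then show ?thesis using False k by (simp add: poly_prod)
      qed
    qed
    then show ?thesis using k A by simp
  qed
  then have "p = 1" using deg cardpos inj by (intro poly_eqI_degree[of "f ` A"]) (auto simp: card_image)
  then have "1 = poly p 0" by simp
  also have "\<dots> = (\<Sum>i\<in>A. (- 1) ^ (card A - 1) * (\<Prod>i\<in>A. f i) * (inverse (f i) / (\<Prod>j\<in>A - {i}. f i - f j)))"
    unfolding p_def poly_sum
  proof (intro sum.cong refl)
    fix i assume i: "i \<in> A"
    \<comment> \<open>At 0 each numerator is a product of \<open>card A - 1\<close> negated nodes,
      whence the sign; the missing node \<open>f i\<close> reappears as
      \<open>inverse (f i)\<close>.\<close>
    have "(\<Prod>j\<in>A - {i}. - f j) = (- 1) ^ (card A - 1) * (\<Prod>j\<in>A - {i}. f j)"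
      using A i by (subst prod_uminus) simp
    moreover have "(\<Prod>i\<in>A. f i) = f i * (\<Prod>j\<in>A - {i}. f j)" using A(1) i by (rule prod.remove)
    ultimately show "poly (smult (inverse (\<Prod>j\<in>A - {i}. f i - f j)) (\<Prod>j\<in>A - {i}. [:- f j, 1:])) 0
        = (- 1) ^ (card A - 1) * (\<Prod>i\<in>A. f i) * (inverse (f i) / (\<Prod>j\<in>A - {i}. f i - f j))"
      using nz[OF i] by (simp add: poly_prod field_simps)
  qed
  also have "\<dots> = (- 1) ^ (card A - 1) * (\<Prod>i\<in>A. f i) * (\<Sum>i\<in>A. inverse (f i) / (\<Prod>j\<in>A - {i}. f i - f j))"
    by (simp only: sum_distrib_left)
  finally have 1: "1 = (- 1) ^ (card A - 1) * (\<Prod>i\<in>A. f i) * (\<Sum>i\<in>A. inverse (f i) / (\<Prod>j\<in>A - {i}. f i - f j))"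
    (is "1 = ?e * ?P * ?S") .
  have "?e * ?e = 1" by (simp flip: power_mult_distrib)
  then have "?S * ?P = ?e * (?e * ?P * ?S)" by (simp add: mult_ac flip: mult.assoc)
  also have "\<dots> = ?e" unfolding 1[symmetric] by simp
  finally show ?thesis using A nz by (simp add: eq_divide_eq)
qed

text \<open>After division by \<open>ln \<rho>\<close> only the coefficients of the logarithm
  survive. Their double sum factors into a sum over \<open>i\<close> and a sum over
  \<open>m\<close>, both given by the interpolation identity, and the two equal signs
  cancel.\<close>

lemma A_asym_leading_order:
  fixes lam sig :: "'n::finite \<Rightarrow> real"
  assumes pos: "\<And>i. lam i > 0" "\<And>i. sig i > 0" and inj: "inj lam" "inj sig"
    and par: "0 < \<eta>" "0 < \<theta>" "\<theta> < 1" "0 < d1" "0 < d2" "0 < \<gamma>th"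
  shows "((\<lambda>\<rho>. A_asym lam sig \<eta> \<theta> d1 d2 \<tau> \<gamma>th \<rho> * \<rho> ^ CARD('n) / ln \<rho>) \<longlongrightarrow>
     (d2 powr \<tau> / (\<eta> * \<theta>) * (\<gamma>th * d1 powr \<tau>)) ^ CARD('n) /
       (fact CARD('n) * fact (CARD('n) - 1) * (\<Prod>i\<in>UNIV. lam i) * (\<Prod>i\<in>UNIV. sig i))) at_top"
proof -
  define N where "N = CARD('n)"
  define D where "D = 1 / fact (N - 1) * (d2 powr \<tau> / (\<eta> * \<theta>)) ^ N"
  define H where "H = (\<Sum>l=1..N-1. 1 / real l) - euler_mascheroni"
  define g where "g = \<gamma>th * d1 powr \<tau>"
  define a where "a i = inverse (lam i) / (\<Prod>j\<in>UNIV - {i}. (lam i - lam j))" for i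
  define b where "b m = inverse (sig m) / (\<Prod>n\<in>UNIV - {m}. (sig m - sig n))" for m
  have g: "g > 0" using par by (simp add: g_def)
  have A: "A_asym lam sig \<eta> \<theta> d1 d2 \<tau> \<gamma>th \<rho> = (\<Sum>i\<in>UNIV. \<Sum>m\<in>UNIV. a i * b m * (1 / fact N) *
      (D * (H + ln ((1 - \<theta>) * \<rho> * lam i / g)) - (- sig m / (1 - \<theta>)) ^ N) * (g / \<rho>) ^ N)" for \<rho>
    unfolding A_asym_def Let_def a_def b_def D_def H_def g_def N_def by (simp add: algebra_simps)
  have lim: "((\<lambda>\<rho>. a i * b m * (1 / fact N) *
      (D * (H + ln ((1 - \<theta>) * \<rho> * lam i / g)) - (- sig m / (1 - \<theta>)) ^ N) * (g / \<rho>) ^ N * \<rho> ^ N / ln \<rho>)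
      \<longlongrightarrow> a i * b m * (1 / fact N) * D * g ^ N) at_top" for i m
  proof -
    define k where "k = (1 - \<theta>) * lam i / g"
    have k: "k > 0" using par pos g by (simp add: k_def)
    have "((\<lambda>\<rho>. (D * (H + ln (k * \<rho>)) - (- sig m / (1 - \<theta>)) ^ N) / ln \<rho>) \<longlongrightarrow> D) at_top"
      using k by real_asymp
    then have "((\<lambda>\<rho>. a i * b m * (1 / fact N) * ((D * (H + ln (k * \<rho>)) - (- sig m / (1 - \<theta>)) ^ N) / ln \<rho>) * g ^ N) \<longlongrightarrow> a i * b m * (1 / fact N) * D * g ^ N) at_top"
      by (intro tendsto_intros)
    then show ?thesis
    proof (rule Lim_transform_eventually)
      show "\<forall>\<^sub>F \<rho> in at_top. a i * b m * (1 / fact N) * ((D * (H + ln (k * \<rho>)) - (- sig m / (1 - \<theta>)) ^ N) / ln \<rho>) * g ^ N =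
        a i * b m * (1 / fact N) *
      (D * (H + ln ((1 - \<theta>) * \<rho> * lam i / g)) - (- sig m / (1 - \<theta>)) ^ N) * (g / \<rho>) ^ N * \<rho> ^ N / ln \<rho>"
        using eventually_gt_at_top[of 0]
      proof eventually_elim
        case (elim \<rho>)
        have "(g / \<rho>) ^ N * \<rho> ^ N = g ^ N" using elim by (simp add: power_divide)
        moreover have "(1 - \<theta>) * \<rho> * lam i / g = k * \<rho>" by (simp add: k_def)
        ultimately show ?case by (simp add: mult.assoc)
      qed
    qed
  qed
  have "((\<lambda>\<rho>. A_asym lam sig \<eta> \<theta> d1 d2 \<tau> \<gamma>th \<rho> * \<rho> ^ N / ln \<rho>) \<longlongrightarrow>
     (\<Sum>i\<in>UNIV. \<Sum>m\<in>UNIV. a i * b m * (1 / fact N) * D * g ^ N)) at_top"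
    unfolding A sum_distrib_right sum_divide_distrib by (intro tendsto_sum lim)
  also have "(\<Sum>i\<in>UNIV. \<Sum>m\<in>UNIV. a i * b m * (1 / fact N) * D * g ^ N) =
      (\<Sum>i\<in>UNIV. a i) * (\<Sum>m\<in>UNIV. b m) * ((1 / fact N) * D * g ^ N)"
    by (subst sum_product) (simp only: sum_distrib_right mult.assoc)
  also have "(\<Sum>i\<in>UNIV. a i) = (- 1) ^ (N - 1) / (\<Prod>i\<in>UNIV. lam i)"
    unfolding a_def N_def using pos(1) inj by (intro sum_inverse_div_prod_diff) (auto simp: less_imp_neq[symmetric])
  also have "(\<Sum>i\<in>UNIV. b i) = (- 1) ^ (N - 1) / (\<Prod>i\<in>UNIV. sig i)"
    unfolding b_def N_def using pos(2) inj by (intro sum_inverse_div_prod_diff) (auto simp: less_imp_neq[symmetric])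
  also have "(- 1) ^ (N - 1) / (\<Prod>i\<in>UNIV. lam i) * ((- 1) ^ (N - 1) / (\<Prod>i\<in>UNIV. sig i)) * ((1 / fact N) * D * g ^ N)
     = (d2 powr \<tau> / (\<eta> * \<theta>) * g) ^ N / (fact N * fact (N - 1) * (\<Prod>i\<in>UNIV. lam i) * (\<Prod>i\<in>UNIV. sig i))"
    by (simp add: D_def power_mult_distrib[symmetric] mult_ac flip: power_mult_distrib)
  finally show ?thesis unfolding N_def g_def .
qed

section \<open>Outage probability\<close>

text \<open>The fraction \<open>q / (p + q + 1)\<close> is below 1, so the ratio never exceeds
  \<open>p\<close>; for \<open>p = 0\<close> strictness comes from
  \<open>\<gamma> > 0\<close>.\<close>

lemma snr_less_if_le:
  fixes p q \<gamma> :: real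
  assumes "p \<ge> 0" "q \<ge> 0" "\<gamma> > 0" "p \<le> \<gamma>"
  shows "p * q / (p + q + 1) < \<gamma>"
proof -
  have "p * q \<le> \<gamma> * q" using assms by (intro mult_right_mono)
  also have "\<dots> < \<gamma> * (p + q + 1)" using assms by simp
  finally show ?thesis using assms by (simp add: pos_divide_less_eq)
qed

text \<open>For \<open>q > \<gamma>\<close> the bound on the ratio means
  \<open>p < \<gamma> * (q + 1) / (q - \<gamma>)\<close>. Here
  \<open>(q + 1) / (q - \<gamma>)\<close> equals \<open>1 + (1 + \<gamma>) / (q - \<gamma>)\<close>,
  which drops below \<open>1 + \<delta>\<close> exactly beyond the stated threshold.\<close>

lemma snr_less_imp:
  fixes p q \<gamma> \<delta> :: real
  assumes "p \<ge> 0" "q \<ge> 0" "\<gamma> > 0" "\<delta> > 0" "p * q / (p + q + 1) < \<gamma>"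
  shows "q \<le> \<gamma> + (1 + \<gamma>) / \<delta> \<or> p \<le> \<gamma> * (1 + \<delta>)"
proof (rule ccontr)
  assume "\<not> ?thesis"
  then have q: "q > \<gamma> + (1 + \<gamma>) / \<delta>" and p: "p > \<gamma> * (1 + \<delta>)" by auto
  have "(1 + \<gamma>) / \<delta> > 0" using assms by simp
  then have "q > \<gamma>" using q by simp
  have "p * q < \<gamma> * (p + q + 1)" using assms by (simp add: pos_divide_less_eq)
  then have "p * (q - \<gamma>) < \<gamma> * (q + 1)" by (simp add: algebra_simps)
  moreover have "\<gamma> * (1 + \<delta>) * (q - \<gamma>) \<le> p * (q - \<gamma>)" using p \<open>q > \<gamma>\<close> by (intro mult_right_mono) auto
  ultimately have "\<gamma> * ((1 + \<delta>) * (q - \<gamma>)) < \<gamma> * (q + 1)" by (simp add: mult.assoc)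
  then have "(1 + \<delta>) * (q - \<gamma>) < q + 1" using assms by simp
  then have "\<delta> * (q - \<gamma>) < 1 + \<gamma>" by (simp add: algebra_simps)
  moreover have "1 + \<gamma> < \<delta> * (q - \<gamma>)" using q assms by (simp add: field_simps)
  ultimately show False by simp
qed

text \<open>The outage event contains a small-ball event of \<open>X * Y\<close> and is contained in
  the union of a slightly larger one with a small-ball event of \<open>X\<close>. The latter has
  probability of order \<open>1 / \<rho> ^ N\<close>, without the logarithm, and is
  negligible.\<close>

proposition (in prob_space) outage_leading_order:
  fixes X Y :: "'a \<Rightarrow> real"
  assumes indep: "indep_var borel X borel Y" and nonneg: "\<And>\<omega>. X \<omega> \<ge> 0" "\<And>\<omega>. Y \<omega> \<ge> 0"
    and N: "N > 0" and c: "c1 > 0" "c2 > 0" and par: "\<beta> > 0" "\<kappa> > 0" "\<gamma> > 0"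
    and l1: "((\<lambda>x. prob {\<omega> \<in> space M. X \<omega> \<le> x} / x ^ N) \<longlongrightarrow> c1) (at_right 0)"
    and l2: "((\<lambda>x. prob {\<omega> \<in> space M. Y \<omega> \<le> x} / x ^ N) \<longlongrightarrow> c2) (at_right 0)"
  shows "((\<lambda>\<rho>. prob {\<omega> \<in> space M. (\<beta> * \<rho> * X \<omega> * Y \<omega>) * (\<kappa> * \<rho> * X \<omega>) /
      (\<beta> * \<rho> * X \<omega> * Y \<omega> + \<kappa> * \<rho> * X \<omega> + 1) < \<gamma>} * \<rho> ^ N / ln \<rho>)
    \<longlongrightarrow> real N * c1 * c2 * (\<gamma> / \<beta>) ^ N) at_top" (is "((\<lambda>\<rho>. ?P \<rho> * \<rho> ^ N / ln \<rho>) \<longlongrightarrow> _) _")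
proof (rule tendsto_sandwich_family)
  have [measurable]: "X \<in> borel_measurable M" "Y \<in> borel_measurable M"
    using indep by (auto dest: indep_var_rv1 indep_var_rv2)
  define \<nu> where "\<nu> = distr M borel X"
  define \<mu> where "\<mu> = distr M borel Y"
  have \<nu>: "prob_space \<nu>" "sets \<nu> = sets borel" and \<mu>: "prob_space \<mu>" "sets \<mu> = sets borel"
    by (auto simp: \<nu>_def \<mu>_def intro: prob_space_distr)
  have F: "measure \<nu> {..x} = prob {\<omega> \<in> space M. X \<omega> \<le> x}" "measure \<mu> {..x} = prob {\<omega> \<in> space M. Y \<omega> \<le> x}" for x
    by (auto simp: \<nu>_def \<mu>_def measure_distr intro!: arg_cong[where f = prob])
  define G where "G t = prob {\<omega> \<in> space M. X \<omega> * Y \<omega> \<le> t}" for t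
  have G: "measure (\<nu> \<Otimes>\<^sub>M \<mu>) {(x, y). x * y \<le> t} = G t" for t
  proof -
    have "{z \<in> space (borel \<Otimes>\<^sub>M borel). fst z * snd z \<le> t} \<in> sets (borel \<Otimes>\<^sub>M (borel :: real measure))"
      by measurable
    then have [measurable]: "{(x, y). x * y \<le> t} \<in> sets (borel \<Otimes>\<^sub>M (borel :: real measure))"
      by (simp add: space_pair_measure case_prod_unfold)
    have "\<nu> \<Otimes>\<^sub>M \<mu> = distr M (borel \<Otimes>\<^sub>M borel) (\<lambda>\<omega>. (X \<omega>, Y \<omega>))"
      using indep by (simp add: \<nu>_def \<mu>_def indep_var_distribution_eq)
    then show ?thesis
      by (simp add: measure_distr G_def) (auto intro!: arg_cong[where f = prob])
  qed
  have Glim: "((\<lambda>t. G t / (t ^ N * ln (1 / t))) \<longlongrightarrow> real N * c1 * c2) (at_right 0)"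
    using product_small_ball_asymptotics[OF \<nu> \<mu> N c] l1 l2 by (simp add: F G)
  have at0: "filterlim (\<lambda>\<rho>. s / \<rho>) (at_right 0) at_top" if "s > 0" for s :: real
    using that by real_asymp
  \<comment> \<open>Substitute \<open>t = s / \<rho>\<close> in the product asymptotics;
    \<open>ln (\<rho> / s)\<close> is equivalent to \<open>ln \<rho>\<close>.\<close>
  have Gs: "((\<lambda>\<rho>. G (s / \<rho>) * \<rho> ^ N / ln \<rho>) \<longlongrightarrow> real N * c1 * c2 * s ^ N) at_top" if s: "s > 0" for s
  proof -
    have "((\<lambda>\<rho>. ln (1 / (s / \<rho>)) / ln \<rho>) \<longlongrightarrow> 1) at_top" using s by real_asymp
    with filterlim_compose[OF Glim at0[OF s]]
    have "((\<lambda>\<rho>. G (s / \<rho>) / ((s / \<rho>) ^ N * ln (1 / (s / \<rho>))) * s ^ N * (ln (1 / (s / \<rho>)) / ln \<rho>))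
        \<longlongrightarrow> real N * c1 * c2 * s ^ N * 1) at_top" by (intro tendsto_intros)
    then have "((\<lambda>\<rho>. G (s / \<rho>) / ((s / \<rho>) ^ N * ln (1 / (s / \<rho>))) * s ^ N * (ln (1 / (s / \<rho>)) / ln \<rho>))
        \<longlongrightarrow> real N * c1 * c2 * s ^ N) at_top" by simp
    then show ?thesis
    proof (rule Lim_transform_eventually)
      show "\<forall>\<^sub>F \<rho> in at_top. G (s / \<rho>) / ((s / \<rho>) ^ N * ln (1 / (s / \<rho>))) * s ^ N * (ln (1 / (s / \<rho>)) / ln \<rho>) = G (s / \<rho>) * \<rho> ^ N / ln \<rho>"
        using eventually_gt_at_top[of "max s 0"]
      proof eventually_elim
        case (elim \<rho>)
        then have "ln (1 / (s / \<rho>)) > 0" using s by simp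
        then have "ln (1 / (s / \<rho>)) \<noteq> 0" by simp
        then show ?case using s elim by (simp add: power_divide)
      qed
    qed
  qed
  \<comment> \<open>After multiplication by \<open>\<rho> ^ N\<close> this probability converges, so
    division by \<open>ln \<rho>\<close> sends it to 0.\<close>
  have Fs: "((\<lambda>\<rho>. prob {\<omega> \<in> space M. X \<omega> \<le> s / \<rho>} * \<rho> ^ N / ln \<rho>) \<longlongrightarrow> 0) at_top" if s: "s > 0" for s
  proof -
    have "((\<lambda>\<rho>::real. 1 / ln \<rho>) \<longlongrightarrow> 0) at_top" by real_asymp
    with filterlim_compose[OF l1 at0[OF s]]
    have "((\<lambda>\<rho>. prob {\<omega> \<in> space M. X \<omega> \<le> s / \<rho>} / (s / \<rho>) ^ N * s ^ N * (1 / ln \<rho>)) \<longlongrightarrow> c1 * s ^ N * 0) at_top"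
      by (intro tendsto_intros)
    then have "((\<lambda>\<rho>. prob {\<omega> \<in> space M. X \<omega> \<le> s / \<rho>} / (s / \<rho>) ^ N * s ^ N * (1 / ln \<rho>)) \<longlongrightarrow> 0) at_top" by simp
    then show ?thesis
    proof (rule Lim_transform_eventually)
      show "\<forall>\<^sub>F \<rho> in at_top. prob {\<omega> \<in> space M. X \<omega> \<le> s / \<rho>} / (s / \<rho>) ^ N * s ^ N * (1 / ln \<rho>) = prob {\<omega> \<in> space M. X \<omega> \<le> s / \<rho>} * \<rho> ^ N / ln \<rho>"
        using eventually_gt_at_top[of 0] by eventually_elim (use s in \<open>simp add: power_divide\<close>)
    qed
  qed
  fix \<delta> :: real assume d: "0 < \<delta>" "\<delta> < 1"
  define K where "K = \<gamma> + (1 + \<gamma>) / \<delta>"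
  have K: "K > 0" using d par by (simp add: K_def add_pos_pos)
  define l where "l = (\<lambda>\<rho>. G ((\<gamma> / \<beta>) / \<rho>) * \<rho> ^ N / ln \<rho>)"
  define u where "u = (\<lambda>\<rho>. prob {\<omega> \<in> space M. X \<omega> \<le> (K / \<kappa>) / \<rho>} * \<rho> ^ N / ln \<rho> + G ((\<gamma> * (1 + \<delta>) / \<beta>) / \<rho>) * \<rho> ^ N / ln \<rho>)"
  have "(l \<longlongrightarrow> real N * c1 * c2 * (\<gamma> / \<beta>) ^ N) at_top"
    unfolding l_def using par by (intro Gs) simp
  moreover have "(u \<longlongrightarrow> 0 + real N * c1 * c2 * (\<gamma> * (1 + \<delta>) / \<beta>) ^ N) at_top"
    unfolding u_def using par K d by (intro tendsto_add Gs Fs) simp_all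
  moreover have "\<forall>\<^sub>F \<rho> in at_top. l \<rho> \<le> ?P \<rho> * \<rho> ^ N / ln \<rho> \<and> ?P \<rho> * \<rho> ^ N / ln \<rho> \<le> u \<rho>"
    using eventually_gt_at_top[of 1]
  proof eventually_elim
    case (elim \<rho>)
    have pq: "\<beta> * \<rho> * X \<omega> * Y \<omega> \<ge> 0" "\<kappa> * \<rho> * X \<omega> \<ge> 0" for \<omega> using elim par nonneg by simp_all
    have "G ((\<gamma> / \<beta>) / \<rho>) \<le> ?P \<rho>"
      unfolding G_def
    proof (intro finite_measure_mono subsetI)
      fix \<omega> assume "\<omega> \<in> {\<omega> \<in> space M. X \<omega> * Y \<omega> \<le> \<gamma> / \<beta> / \<rho>}"
      then have "\<omega> \<in> space M" "\<beta> * \<rho> * X \<omega> * Y \<omega> \<le> \<gamma>" using par elim by (auto simp: field_simps)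
      then show "\<omega> \<in> {\<omega> \<in> space M. (\<beta> * \<rho> * X \<omega> * Y \<omega>) * (\<kappa> * \<rho> * X \<omega>) /
        (\<beta> * \<rho> * X \<omega> * Y \<omega> + \<kappa> * \<rho> * X \<omega> + 1) < \<gamma>}"
        using snr_less_if_le[OF pq par(3)] by blast
    qed measurable
    moreover have "?P \<rho> \<le> prob ({\<omega> \<in> space M. X \<omega> \<le> (K / \<kappa>) / \<rho>} \<union> {\<omega> \<in> space M. X \<omega> * Y \<omega> \<le> (\<gamma> * (1 + \<delta>) / \<beta>) / \<rho>})"
    proof (intro finite_measure_mono subsetI)
      fix \<omega> assume "\<omega> \<in> {\<omega> \<in> space M. (\<beta> * \<rho> * X \<omega> * Y \<omega>) * (\<kappa> * \<rho> * X \<omega>) /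
        (\<beta> * \<rho> * X \<omega> * Y \<omega> + \<kappa> * \<rho> * X \<omega> + 1) < \<gamma>}"
      then have "\<omega> \<in> space M" "\<kappa> * \<rho> * X \<omega> \<le> K \<or> \<beta> * \<rho> * X \<omega> * Y \<omega> \<le> \<gamma> * (1 + \<delta>)"
        using snr_less_imp[OF pq par(3) d(1)] unfolding K_def by blast+
      then show "\<omega> \<in> {\<omega> \<in> space M. X \<omega> \<le> (K / \<kappa>) / \<rho>} \<union> {\<omega> \<in> space M. X \<omega> * Y \<omega> \<le> (\<gamma> * (1 + \<delta>) / \<beta>) / \<rho>}"
        using par elim by (auto simp: pos_le_divide_eq mult_ac)
    qed measurable
    moreover have "\<dots> \<le> prob {\<omega> \<in> space M. X \<omega> \<le> (K / \<kappa>) / \<rho>} + G ((\<gamma> * (1 + \<delta>) / \<beta>) / \<rho>)"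
      unfolding G_def by (intro measure_Un_le) measurable
    ultimately have b: "G ((\<gamma> / \<beta>) / \<rho>) \<le> ?P \<rho>"
      "?P \<rho> \<le> prob {\<omega> \<in> space M. X \<omega> \<le> (K / \<kappa>) / \<rho>} + G ((\<gamma> * (1 + \<delta>) / \<beta>) / \<rho>)" by linarith+
    have pos: "\<rho> ^ N / ln \<rho> \<ge> 0" using elim by simp
    show ?case
      using mult_right_mono[OF b(1) pos] mult_right_mono[OF b(2) pos]
      unfolding l_def u_def by (simp add: algebra_simps add_divide_distrib)
  qed
  ultimately show "\<exists>l u. (l \<longlongrightarrow> real N * c1 * c2 * (\<gamma> / \<beta>) ^ N) at_top \<and>
      (u \<longlongrightarrow> real N * c1 * c2 * (\<gamma> * (1 + \<delta>) / \<beta>) ^ N) at_top \<and>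
      (\<forall>\<^sub>F \<rho> in at_top. l \<rho> \<le> ?P \<rho> * \<rho> ^ N / ln \<rho> \<and> ?P \<rho> * \<rho> ^ N / ln \<rho> \<le> u \<rho>)"
    by (intro exI[of _ l] exI[of _ u]) simp
qed (use par in \<open>auto intro!: tendsto_eq_intros\<close>)

section \<open>Application to the correlated channel vectors\<close>

lemma gammaI_eq_harmonic_form:
  assumes "0 < d1" "0 < d2"
  shows "gammaI \<eta> \<theta> d1 d2 \<tau> \<rho> h1 h2 =
    (let p = \<eta> * \<theta> / (d1 powr \<tau> * d2 powr \<tau>) * \<rho> * (norm h1)\<^sup>2 * (norm h2)\<^sup>2;
         q = (1 - \<theta>) / d1 powr \<tau> * \<rho> * (norm h1)\<^sup>2
     in p * q / (p + q + 1))"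
proof -
  \<comment> \<open>With this square, the numerator of \<open>gammaI\<close> is the product of the
    first two summands \<open>p\<close> and \<open>q\<close> of its denominator.\<close>
  have "d1 powr (2 * \<tau>) = (d1 powr \<tau>)\<^sup>2"
    using assms by (simp add: powr_add[symmetric] power2_eq_square)
  then show ?thesis
    unfolding gammaI_def Let_def by (simp add: power2_eq_square power4_eq_xxxx mult_ac)
qed

lemma borel_measurable_mult_vec [measurable]:
  "(\<lambda>z. A *v z) \<in> borel_measurable (borel :: (complex^'n) measure)"
  unfolding matrix_vector_mult_def by (intro borel_measurable_vec_lambda) measurable

lemma borel_measurable_vec_mult [measurable]:
  "(\<lambda>z. z v* A) \<in> borel_measurable (borel :: (complex^'n) measure)"
  unfolding vector_matrix_mult_def by (intro borel_measurable_vec_lambda) measurable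

text \<open>All entries of both vectors form one family over \<open>bool \<times> 'n\<close>, so a
  single independence assumption covers independence within each vector and between the two.
  Probability and approximation are shown to have the same positive limit after scaling by
  \<open>\<rho> ^ N / ln \<rho>\<close>.\<close>

theorem theorem3:
  fixes M :: "'a measure"
    and Rr Rt :: "complex^'n^'n"
    and lam sig :: "'n \<Rightarrow> real"
    and hw1 hw2 :: "'a \<Rightarrow> complex^'n"
    and \<eta> \<theta> d1 d2 \<tau> \<gamma>th :: real
  assumes "prob_space M"
    and "\<And>b k. distributed M lborel (\<lambda>\<omega>. (if b then hw1 \<omega> else hw2 \<omega>) $ k) cn_density"
    and "prob_space.indep_vars M (\<lambda>_. borel)
           (\<lambda>(b, k) \<omega>. (if b then hw1 \<omega> else hw2 \<omega>) $ k) (UNIV :: (bool \<times> 'n) set)"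
    and "pos_def Rr" and "pos_def Rt"
    and "{c. is_eigenvalue Rr c} = complex_of_real ` range lam"
    and "{c. is_eigenvalue Rt c} = complex_of_real ` range sig"
    and "\<And>i. lam i > 0" and "\<And>i. sig i > 0"
    and "inj lam" and "inj sig"
    and "0 < \<eta>" and "\<eta> \<le> 1" and "0 < \<theta>" and "\<theta> < 1"
    and "0 < d1" and "0 < d2" and "0 < \<tau>" and "0 < \<gamma>th"
  shows "((\<lambda>\<rho>. measure M {\<omega> \<in> space M.
             gammaI \<eta> \<theta> d1 d2 \<tau> \<rho> (msqrt Rr *v hw1 \<omega>) (hw2 \<omega> v* msqrt Rt) < \<gamma>th}
           / A_asym lam sig \<eta> \<theta> d1 d2 \<tau> \<gamma>th \<rho>) \<longlongrightarrow> 1) at_top"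
proof -
  interpret prob_space M by fact
  define N where "N = CARD('n)"
  have N: "N > 0" by (simp add: N_def)
  define Z where "Z = (\<lambda>(b, k) \<omega>. (if b then hw1 \<omega> else hw2 \<omega>) $ (k :: 'n))"
  have indepZ: "indep_vars (\<lambda>_. borel) Z UNIV" using assms(3) by (simp add: Z_def)
  have block: "indep_vars (\<lambda>_. borel) (\<lambda>k \<omega>. (if b then hw1 \<omega> else hw2 \<omega>) $ k) UNIV" for b
  proof -
    \<comment> \<open>A subfamily is obtained by restricting to the disjoint singletons
      \<open>{(b, k)}\<close> and then evaluating at their only point.\<close>
    have "indep_vars (\<lambda>k. Pi\<^sub>M {(b, k)} (\<lambda>_. borel)) (\<lambda>k \<omega>. restrict (\<lambda>p. Z p \<omega>) {(b, k)}) UNIV"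
      by (rule indep_vars_restrict[OF indepZ]) (auto simp: disjoint_family_on_def)
    then have "indep_vars (\<lambda>_. borel) (\<lambda>k \<omega>. (\<lambda>f. f (b, k)) (restrict (\<lambda>p. Z p \<omega>) {(b, k)})) UNIV"
      by (rule indep_vars_compose2) auto
    then show ?thesis by (simp add: Z_def)
  qed
  have d1: "distributed M lborel (\<lambda>\<omega>. hw1 \<omega> $ k) cn_density" and d2: "distributed M lborel (\<lambda>\<omega>. hw2 \<omega> $ k) cn_density" for k
    using assms(2)[of True k] assms(2)[of False k] by simp_all
  have i1: "indep_vars (\<lambda>_. borel) (\<lambda>k \<omega>. hw1 \<omega> $ k) UNIV" and i2: "indep_vars (\<lambda>_. borel) (\<lambda>k \<omega>. hw2 \<omega> $ k) UNIV"
    using block[of True] block[of False] by simp_all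
  define X where "X \<omega> = (norm (msqrt Rr *v hw1 \<omega>))\<^sup>2" for \<omega>
  define Y where "Y \<omega> = (norm (hw2 \<omega> v* msqrt Rt))\<^sup>2" for \<omega>
  have "is_eigenvalue Rr (of_real (lam i))" "is_eigenvalue Rt (of_real (sig i))" for i
    using assms(6,7) by blast+
  moreover have "hermitian Rr" "hermitian Rt" using assms(4,5) by (auto simp: pos_def_def)
  ultimately obtain g1 g2 where
    g1: "orthogonal_transformation g1" "\<And>z. (norm (msqrt Rr *v z))\<^sup>2 = (\<Sum>i\<in>UNIV. lam i * (cmod (g1 z $ i))\<^sup>2)" and
    g2: "orthogonal_transformation g2" "\<And>z. (norm (z v* msqrt Rt))\<^sup>2 = (\<Sum>i\<in>UNIV. sig i * (cmod (g2 z $ i))\<^sup>2)"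
    using norm_msqrt_mult_vec(1)[of Rr lam] norm_msqrt_mult_vec(2)[of Rt sig] assms(8-11) by blast
  define c1 c2 where "c1 = 1 / (fact N * (\<Prod>i\<in>UNIV. lam i))" and "c2 = 1 / (fact N * (\<Prod>i\<in>UNIV. sig i))"
  have c: "c1 > 0" "c2 > 0" using assms(8,9) by (auto simp: c1_def c2_def prod_pos)
  have l1: "((\<lambda>x. prob {\<omega> \<in> space M. X \<omega> \<le> x} / x ^ N) \<longlongrightarrow> c1) (at_right 0)"
    unfolding X_def c1_def N_def by (rule gaussian_quadratic_form_small_ball[OF d1 i1 assms(8) g1])
  have l2: "((\<lambda>x. prob {\<omega> \<in> space M. Y \<omega> \<le> x} / x ^ N) \<longlongrightarrow> c2) (at_right 0)"
    unfolding Y_def c2_def N_def by (rule gaussian_quadratic_form_small_ball[OF d2 i2 assms(9) g2])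
  \<comment> \<open>\<open>X\<close> and \<open>Y\<close> are measurable functions of the disjoint
    blocks with first index \<open>True\<close> and \<open>False\<close>.\<close>
  have indep: "indep_var borel X borel Y"
  proof -
    let ?A = "{True} \<times> (UNIV :: 'n set)" and ?B = "{False} \<times> (UNIV :: 'n set)"
    define fX where "fX f = (norm (msqrt Rr *v (\<chi> k. f (True, k))))\<^sup>2" for f :: "bool \<times> 'n \<Rightarrow> complex"
    define fY where "fY f = (norm ((\<chi> k. f (False, k)) v* msqrt Rt))\<^sup>2" for f :: "bool \<times> 'n \<Rightarrow> complex"
    have [measurable]: "(\<lambda>f. \<chi> k. f (True, k)) \<in> borel_measurable (Pi\<^sub>M ?A (\<lambda>_. borel :: complex measure))"
      "(\<lambda>f. \<chi> k. f (False, k)) \<in> borel_measurable (Pi\<^sub>M ?B (\<lambda>_. borel :: complex measure))"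
      by (intro borel_measurable_vec_lambda measurable_component_singleton; simp)+
    have "fX \<in> borel_measurable (Pi\<^sub>M ?A (\<lambda>_. borel))" "fY \<in> borel_measurable (Pi\<^sub>M ?B (\<lambda>_. borel))"
      unfolding fX_def fY_def by measurable
    from indep_var_compose[OF indep_var_restrict[OF indepZ, of ?A ?B] this]
    have "indep_var borel (fX \<circ> (\<lambda>\<omega>. restrict (\<lambda>i. Z i \<omega>) ?A)) borel (fY \<circ> (\<lambda>\<omega>. restrict (\<lambda>i. Z i \<omega>) ?B))"
      by auto
    moreover have "fX \<circ> (\<lambda>\<omega>. restrict (\<lambda>i. Z i \<omega>) ?A) = X" "fY \<circ> (\<lambda>\<omega>. restrict (\<lambda>i. Z i \<omega>) ?B) = Y"
      by (auto simp: fun_eq_iff fX_def fY_def X_def Y_def Z_def)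
    ultimately show ?thesis by simp
  qed
  define P where "P \<rho> = measure M {\<omega> \<in> space M.
      gammaI \<eta> \<theta> d1 d2 \<tau> \<rho> (msqrt Rr *v hw1 \<omega>) (hw2 \<omega> v* msqrt Rt) < \<gamma>th}" for \<rho>
  define L where "L = (d2 powr \<tau> / (\<eta> * \<theta>) * (\<gamma>th * d1 powr \<tau>)) ^ N /
       (fact N * fact (N - 1) * (\<Prod>i\<in>UNIV. lam i) * (\<Prod>i\<in>UNIV. sig i))"
  \<comment> \<open>Positivity of \<open>L\<close> allows the two limits to be divided.\<close>
  have Lpos: "L > 0" using assms(8,9,12-19) by (simp add: L_def prod_pos)
  have Plim: "((\<lambda>\<rho>. P \<rho> * \<rho> ^ N / ln \<rho>) \<longlongrightarrow> L) at_top"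
  proof -
    have "((\<lambda>\<rho>. P \<rho> * \<rho> ^ N / ln \<rho>) \<longlongrightarrow> real N * c1 * c2 * (\<gamma>th / (\<eta> * \<theta> / (d1 powr \<tau> * d2 powr \<tau>))) ^ N) at_top"
      unfolding P_def gammaI_eq_harmonic_form[OF \<open>0 < d1\<close> \<open>0 < d2\<close>] Let_def X_def[symmetric] Y_def[symmetric]
      by (rule outage_leading_order[OF indep _ _ N c _ _ _ l1 l2])
        (use assms(12-19) in \<open>simp_all add: X_def Y_def\<close>)
    also have "real N * c1 * c2 * (\<gamma>th / (\<eta> * \<theta> / (d1 powr \<tau> * d2 powr \<tau>))) ^ N = L"
    proof -
      \<comment> \<open>One factor \<open>N\<close> cancels against one of the two factorials,
        leaving \<open>fact N * fact (N - 1)\<close>.\<close>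
      have "real N * c1 * c2 = 1 / (fact N * fact (N - 1) * (\<Prod>i\<in>UNIV. lam i) * (\<Prod>i\<in>UNIV. sig i))"
        using N fact_num_eq_if[of N, where 'a = real] by (simp add: c1_def c2_def)
      moreover have "\<gamma>th / (\<eta> * \<theta> / (d1 powr \<tau> * d2 powr \<tau>)) = d2 powr \<tau> / (\<eta> * \<theta>) * (\<gamma>th * d1 powr \<tau>)"
        by (simp add: mult_ac)
      ultimately show ?thesis by (simp only: L_def) simp
    qed
    finally show ?thesis .
  qed
  have "((\<lambda>\<rho>. A_asym lam sig \<eta> \<theta> d1 d2 \<tau> \<gamma>th \<rho> * \<rho> ^ N / ln \<rho>) \<longlongrightarrow> L) at_top"
    unfolding L_def N_def using assms(8-19) by (intro A_asym_leading_order) auto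
  from tendsto_divide[OF Plim this] Lpos
  have "((\<lambda>\<rho>. (P \<rho> * \<rho> ^ N / ln \<rho>) / (A_asym lam sig \<eta> \<theta> d1 d2 \<tau> \<gamma>th \<rho> * \<rho> ^ N / ln \<rho>)) \<longlongrightarrow> 1) at_top"
    by simp
  then show ?thesis
    unfolding P_def[symmetric]
  proof (rule Lim_transform_eventually)
    show "\<forall>\<^sub>F \<rho> in at_top. (P \<rho> * \<rho> ^ N / ln \<rho>) / (A_asym lam sig \<eta> \<theta> d1 d2 \<tau> \<gamma>th \<rho> * \<rho> ^ N / ln \<rho>) =
        P \<rho> / A_asym lam sig \<eta> \<theta> d1 d2 \<tau> \<gamma>th \<rho>"
      using eventually_gt_at_top[of 1]
    proof eventually_elim
      case (elim \<rho>)
      then have "\<rho> ^ N \<noteq> 0" "ln \<rho> \<noteq> 0" by auto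
      then show ?case by simp
    qed
  qed
qed

end
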